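(* There is an absolute constant $C>0$ (independent of the dimension) such that for every $n\in\mathbb{N}$, $n\ge 1$, and every $f\in L^1(\mathbb{R}^n)$, $$\|\mathcal{M}f\|_{L^{1,\infty}(\mathbb{R}^n)}\le C\sqrt{n}\,\log(1+n)\,\|f\|_{L^1(\mathbb{R}^n)}.$$
   Context: $\mathcal{M}$ is the centered Hardy--Littlewood maximal function over Euclidean balls: for $f\in L^1_{\mathrm{loc}}(\mathbb{R}^n)$, $$\mathcal{M}f(x)=\sup_{r>0}\frac{1}{\omega_n r^n}\int_{B(x,r)}|f(y)|\,dy,$$ where $B(x,r)$ is the Euclidean ball and $\omega_n=\pi^{n/2}/\Gamma(n/2+1)$ is the Lebesgue measure of the unit ball of $\mathbb{R}^n$. The weak-$L^1$ quasinorm is $\|g\|_{L^{1,\infty}(\mathbb{R}^n)}=\sup_{\alpha>0}\alpha\,|\{x\in\mathbb{R}^n: |g(x)|>\alpha\}|$, with $|\cdot|$ of a set denoting Lebesgue measure. *)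

theory Defs
  imports "HOL-Analysis.Analysis"
begin

text \<open>
  The constant of the theorem is uniform in the dimension \<open>n\<close>, so \<open>n\<close> must be quantified inside
  the formula and cannot be a type.  Points of n-space are therefore functions on the index set
  \<open>{..<n}\<close>, extensional outside it, and the underlying measure is the completion of the n-fold
  product of the Borel-Lebesgue measure on the real line.
\<close>

definition lebesgue_n :: "nat \<Rightarrow> (nat \<Rightarrow> real) measure" where
  "lebesgue_n n = completion (Pi\<^sub>M {..<n} (\<lambda>_. lborel))"

definition ball_n :: "nat \<Rightarrow> (nat \<Rightarrow> real) \<Rightarrow> real \<Rightarrow> (nat \<Rightarrow> real) set" where
  "ball_n n x r = {y \<in> space (lebesgue_n n). L2_set (\<lambda>i. y i - x i) {..<n} < r}"

text \<open>
  The supremum may be infinite at individual points, hence the values in \<open>ennreal\<close>.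
  The library constant \<open>unit_ball_vol n\<close> is \<open>pi powr (n / 2) / Gamma (n / 2 + 1)\<close>.
\<close>

definition maximal_fun ::
    "nat \<Rightarrow> ((nat \<Rightarrow> real) \<Rightarrow> 'a::real_normed_vector) \<Rightarrow> (nat \<Rightarrow> real) \<Rightarrow> ennreal" where
  "maximal_fun n f x =
     (SUP r\<in>{0<..}. (\<integral>\<^sup>+ y\<in>ball_n n x r. ennreal (norm (f y)) \<partial>lebesgue_n n)
                      / ennreal (unit_ball_vol (real n) * r ^ n))"

text \<open>
  For functions with values in \<open>[0, \<infinity>]\<close>, so no absolute value is needed.  Note that \<open>emeasure\<close> is 0
  on non-measurable sets; the superlevel sets of a maximal function are open, hence measurable.
\<close>

definition weak_L1_quasinorm :: "nat \<Rightarrow> ((nat \<Rightarrow> real) \<Rightarrow> ennreal) \<Rightarrow> ennreal" where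
  "weak_L1_quasinorm n g =
     (SUP \<alpha>\<in>{0<..}. ennreal \<alpha> * emeasure (lebesgue_n n) {x \<in> space (lebesgue_n n). ennreal \<alpha> < g x})"

end

theory Submission
  imports Defs "HOL-Probability.Distributions"
begin

text \<open>
  Averages over Euclidean balls are bounded by \<open>O(sqrt n)\<close> times the Gaussian extension of \<open>|f|\<close> at a
  suitable time, so it suffices that the maximal function of the heat semigroup is of weak type
  (1,1) with constant \<open>O(log n)\<close>.  This holds for any symmetric Markov operator \<open>P\<close> and times that
  form a grid with \<open>n\<close> points in each octave.

  Within an octave, \<open>min (P\<^sup>t f) c\<close> is the evolution of its value at the beginning of the octave
  plus the evolutions of the Jensen gaps created in each of the \<open>n\<close> steps.  The gaps are bounded
  functions whose integrals telescope to at most the integral of \<open>f\<close>.  By Rota's observation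
  that \<open>P\<^sup>2\<^sup>m h\<close> is a conditional expectation of a reversed martingale, the supremum over all times of
  the evolution of a bounded function \<open>h\<close>, up to an error \<open>O(1 / n)\<close>, costs only a factor \<open>O(log n)\<close>
  in the integral.  The value at the beginning of an octave is controlled by the maximal function
  over dyadic times.  There the gaps also show that, off a small set, \<open>P\<^sup>t f x\<close> cannot drop abruptly
  after a dyadic time, so the time averages are large as well and Hopf's maximal inequality applies.
\<close>

subsection \<open>Symmetric Markov kernels\<close>

text \<open>A discrete layer-cake formula: if \<open>2 ^ L\<close> is the last level exceeded, then
  1 and the levels up to it add up to \<open>2 ^ (L + 1)\<close>, which bounds \<open>u\<close>. The
  number \<open>J\<close> of layers becomes the logarithmic factor later.\<close>

lemma dyadic_layers:
  fixes u :: ennreal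
  assumes "u \<le> 2 ^ J"
  shows "u \<le> 1 + (\<Sum>i<J. 2 ^ i * (if u > 2 ^ i then 1 else 0))"
  using assms
proof (induction J arbitrary: u)
  case (Suc J)
  show ?case
  proof (cases "u \<le> 2 ^ J")
    case True
    then show ?thesis using Suc.IH[OF True] by (simp add: leD)
  next
    case False
    have less: "u > 2 ^ i" if "i \<le> J" for i
    proof -
      have "2 ^ i \<le> (2 ^ J :: ennreal)"
        by (rule lift_Suc_mono_le[OF _ that]) (simp add: mult_2)
      with False show ?thesis by order
    qed
    have "1 + (\<Sum>i<L. 2 ^ i) = (2 ^ L :: ennreal)" for L
      by (induction L) (auto simp: add.assoc[symmetric] mult_2)
    then have "1 + (\<Sum>i<Suc J. 2 ^ i * (if u > 2 ^ i then 1 else 0)) = (2 ^ Suc J :: ennreal)"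
      using less by (simp del: sum.lessThan_Suc power_Suc)
    then show ?thesis using Suc.prems by simp
  qed
qed simp

lemma le_minus_add: "a \<le> (a - b) + (b :: ennreal)"
  using diff_add_cancel_ennreal[of b a] by (cases "b \<le> a") (auto simp: not_le add_increasing)

text \<open>Values in \<open>ennreal\<close> make the operator positive, symmetry makes it
  self-adjoint, and with total mass 1 it preserves integrals. The maximal inequalities rest on these
  properties alone, so their constants are the same for every kernel and every time step.\<close>

locale symmetric_markov_kernel = sigma_finite_measure M for M :: "'a measure" +
  fixes k :: "'a \<Rightarrow> 'a \<Rightarrow> ennreal"
  assumes k_measurable: "case_prod k \<in> borel_measurable (M \<Otimes>\<^sub>M M)"
    and k_sym: "\<And>x y. k x y = k y x"
    and k_total: "\<And>x. x \<in> space M \<Longrightarrow> (\<integral>\<^sup>+y. k x y \<partial>M) = 1"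
begin

lemma k_measurable' [measurable (raw)]:
  assumes "g \<in> N \<rightarrow>\<^sub>M M" "h \<in> N \<rightarrow>\<^sub>M M"
  shows "(\<lambda>x. k (g x) (h x)) \<in> borel_measurable N"
  using measurable_compose[OF measurable_Pair[OF assms] k_measurable] by simp

definition P :: "('a \<Rightarrow> ennreal) \<Rightarrow> 'a \<Rightarrow> ennreal" where
  "P g x = (\<integral>\<^sup>+y. k x y * g y \<partial>M)"

lemma P_measurable [measurable]:
  assumes [measurable]: "g \<in> borel_measurable M"
  shows "P g \<in> borel_measurable M"
  unfolding P_def[abs_def] by measurable

lemma P_mono:
  assumes "\<And>y. y \<in> space M \<Longrightarrow> g y \<le> h y"
  shows "P g x \<le> P h x"
  unfolding P_def by (intro nn_integral_mono mult_left_mono assms) auto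

lemma P_add:
  assumes [measurable]: "g \<in> borel_measurable M" "h \<in> borel_measurable M" and x: "x \<in> space M"
  shows "P (\<lambda>y. g y + h y) x = P g x + P h x"
  unfolding P_def using x by (simp add: distrib_left nn_integral_add)

lemma P_cmult:
  assumes [measurable]: "g \<in> borel_measurable M" and x: "x \<in> space M"
  shows "P (\<lambda>y. c * g y) x = c * P g x"
  unfolding P_def using x
  by (subst nn_integral_cmult[symmetric]) (auto simp: ac_simps)

lemma P_const:
  assumes x: "x \<in> space M" shows "P (\<lambda>_. c) x = c"
  unfolding P_def using x k_total[OF x] by (subst nn_integral_multc) auto

lemma P_symmetric:
  assumes [measurable]: "g \<in> borel_measurable M" "h \<in> borel_measurable M"
  shows "(\<integral>\<^sup>+x. h x * P g x \<partial>M) = (\<integral>\<^sup>+x. P h x * g x \<partial>M)"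
proof -
  interpret pair_sigma_finite M M ..
  have "(\<integral>\<^sup>+x. h x * P g x \<partial>M) = (\<integral>\<^sup>+x. \<integral>\<^sup>+y. h x * (k x y * g y) \<partial>M \<partial>M)"
    unfolding P_def by (intro nn_integral_cong nn_integral_cmult[symmetric]) measurable
  also have "\<dots> = (\<integral>\<^sup>+y. \<integral>\<^sup>+x. h x * (k x y * g y) \<partial>M \<partial>M)"
    by (rule Fubini'[symmetric]) measurable
  also have "\<dots> = (\<integral>\<^sup>+y. P h y * g y \<partial>M)"
    unfolding P_def by (intro nn_integral_cong, subst nn_integral_multc[symmetric], measurable)
      (auto intro!: nn_integral_cong simp: ac_simps k_sym)
  finally show ?thesis .
qed

abbreviation Pn :: "nat \<Rightarrow> ('a \<Rightarrow> ennreal) \<Rightarrow> 'a \<Rightarrow> ennreal" where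
  "Pn m \<equiv> P ^^ m"

lemma Pn_measurable [measurable]:
  assumes [measurable]: "g \<in> borel_measurable M"
  shows "Pn m g \<in> borel_measurable M"
  by (induction m) auto

lemma Pn_Pn: "Pn i (Pn j g) = Pn (i + j) g"
  by (simp add: funpow_add)

lemma Pn_mono:
  assumes "\<And>y. y \<in> space M \<Longrightarrow> g y \<le> h y" "x \<in> space M"
  shows "Pn m g x \<le> Pn m h x"
  using assms(2) by (induction m arbitrary: x) (auto intro: P_mono assms(1))

lemma P_cong:
  assumes "\<And>y. y \<in> space M \<Longrightarrow> g y = h y"
  shows "P g x = P h x"
  by (intro antisym P_mono) (auto simp: assms)

lemma Pn_add:
  assumes [measurable]: "g \<in> borel_measurable M" "h \<in> borel_measurable M" and x: "x \<in> space M"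
  shows "Pn m (\<lambda>y. g y + h y) x = Pn m g x + Pn m h x"
  using x
proof (induction m arbitrary: x)
  case (Suc m)
  have "P (Pn m (\<lambda>y. g y + h y)) x = P (\<lambda>y. Pn m g y + Pn m h y) x"
    by (intro P_cong Suc)
  with Suc.prems show ?case by (simp add: P_add)
qed simp

lemma Pn_cmult:
  assumes [measurable]: "g \<in> borel_measurable M" and x: "x \<in> space M"
  shows "Pn m (\<lambda>y. c * g y) x = c * Pn m g x"
  using x
proof (induction m arbitrary: x)
  case (Suc m)
  have "P (Pn m (\<lambda>y. c * g y)) x = P (\<lambda>y. c * Pn m g y) x"
    by (intro P_cong Suc)
  with Suc.prems show ?case by (simp add: P_cmult)
qed simp

lemma Pn_const:
  assumes x: "x \<in> space M" shows "Pn m (\<lambda>_. c) x = c"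
  using x
proof (induction m arbitrary: x)
  case (Suc m)
  have "P (Pn m (\<lambda>y. c)) x = P (\<lambda>y. c) x"
    by (intro P_cong Suc)
  with Suc.prems show ?case by (simp add: P_const)
qed simp

lemma Pn_sum:
  assumes [measurable]: "\<And>i. i \<in> I \<Longrightarrow> g i \<in> borel_measurable M" and x: "x \<in> space M"
  shows "Pn m (\<lambda>y. \<Sum>i\<in>I. g i y) x = (\<Sum>i\<in>I. Pn m (g i) x)"
  using assms(1)
proof (induction I rule: infinite_finite_induct)
  case (insert i I)
  note [measurable] = insert.prems
  show ?case using insert x by (simp add: Pn_add)
qed (use x in \<open>auto simp: Pn_const\<close>)

lemma Pn_symmetric:
  assumes [measurable]: "g \<in> borel_measurable M" "h \<in> borel_measurable M"
  shows "(\<integral>\<^sup>+x. h x * Pn m g x \<partial>M) = (\<integral>\<^sup>+x. Pn m h x * g x \<partial>M)"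
  using assms(2)
proof (induction m arbitrary: h)
  case (Suc m)
  note [measurable] = Suc.prems
  have "(\<integral>\<^sup>+x. h x * P (Pn m g) x \<partial>M) = (\<integral>\<^sup>+x. Pn m (P h) x * g x \<partial>M)"
    using Suc.IH[of "P h"] by (simp add: P_symmetric)
  then show ?case by (simp add: funpow_swap1)
qed simp

lemma nn_integral_Pn:
  assumes [measurable]: "g \<in> borel_measurable M"
  shows "(\<integral>\<^sup>+x. Pn m g x \<partial>M) = (\<integral>\<^sup>+x. g x \<partial>M)"
proof -
  have "(\<integral>\<^sup>+x. Pn m g x \<partial>M) = (\<integral>\<^sup>+x. 1 * Pn m g x \<partial>M)" by simp
  also have "\<dots> = (\<integral>\<^sup>+x. Pn m (\<lambda>_. 1) x * g x \<partial>M)" by (rule Pn_symmetric) auto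
  also have "\<dots> = (\<integral>\<^sup>+x. g x \<partial>M)" by (intro nn_integral_cong) (simp add: Pn_const)
  finally show ?thesis .
qed

text \<open>Jensen's inequality for the concave truncation at \<open>c\<close>.\<close>

lemma Pn_min_le:
  assumes [measurable]: "g \<in> borel_measurable M" and x: "x \<in> space M"
  shows "Pn m (\<lambda>y. min (g y) c) x \<le> min (Pn m g x) c"
  using Pn_mono[of "\<lambda>y. min (g y) c" g x m] Pn_mono[of "\<lambda>y. min (g y) c" "\<lambda>_. c" x m] x
  by (simp add: Pn_const)

subsection \<open>Doob's inequality and Rota's averaging\<close>

text \<open>
  Let \<open>(X\<^sub>j)\<close> be the stationary reversible chain of \<open>P\<close>.  Then \<open>hit lam K h x\<close> is the probability,
  given \<open>X\<^sub>0 = x\<close>, that the reversed martingale \<open>P\<^sup>j h (X\<^sub>j) = E(h (X\<^sub>0) | X\<^sub>j, X\<^sub>j\<^sub>+\<^sub>1, \<dots>)\<close> exceeds \<open>lam\<close>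
  for some \<open>j \<le> K\<close>.
\<close>

primrec hit :: "ennreal \<Rightarrow> nat \<Rightarrow> ('a \<Rightarrow> ennreal) \<Rightarrow> 'a \<Rightarrow> ennreal" where
  "hit lam 0 h = (\<lambda>x. if h x > lam then 1 else 0)"
| "hit lam (Suc K) h = (\<lambda>x. if h x > lam then 1 else P (hit lam K (P h)) x)"

lemma hit_measurable [measurable]:
  "h \<in> borel_measurable M \<Longrightarrow> hit lam K h \<in> borel_measurable M"
  by (induction K arbitrary: h) auto

lemma hit_le_1: "x \<in> space M \<Longrightarrow> hit lam K h x \<le> 1"
proof (induction K arbitrary: h x)
  case (Suc K)
  have "P (hit lam K (P h)) x \<le> P (\<lambda>_. 1) x" by (intro P_mono Suc.IH)
  with Suc.prems show ?case by (simp add: P_const)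
qed simp

text \<open>Doob's inequality, with paths split by their last exceedance, which is the first one in
  reversed time. Later exceedances are covered by the induction hypothesis for \<open>P h\<close>,
  after which \<open>P_symmetric\<close> moves \<open>P\<close> from \<open>h\<close> to the hit
  probability.\<close>

lemma nn_integral_hit_le:
  "h \<in> borel_measurable M \<Longrightarrow> lam * (\<integral>\<^sup>+x. hit lam K h x \<partial>M) \<le> (\<integral>\<^sup>+x. h x * hit lam K h x \<partial>M)"
proof (induction K arbitrary: h)
  case 0
  note [measurable] = 0
  show ?case
    by (subst nn_integral_cmult[symmetric]) (auto intro!: nn_integral_mono)
next
  case (Suc K)
  note [measurable] = Suc.prems
  define r where "r = hit lam K (P h)"
  have [measurable]: "r \<in> borel_measurable M" unfolding r_def by measurable
  \<comment> \<open>The probability, given the start at \<open>x\<close>, that time 0 is the last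
    exceedance.\<close>
  define b where "b x = (if h x > lam then 1 - P r x else 0)" for x
  have [measurable]: "b \<in> borel_measurable M" unfolding b_def by measurable
  have Pr: "P r x \<le> 1" if "x \<in> space M" for x
  proof -
    have "P r x \<le> P (\<lambda>_. 1) x" unfolding r_def by (intro P_mono hit_le_1)
    then show ?thesis using that by (simp add: P_const)
  qed
  have eq: "hit lam (Suc K) h x = P r x + b x" if "x \<in> space M" for x
    using Pr[OF that] by (auto simp: b_def r_def)
  have "lam * (\<integral>\<^sup>+x. hit lam (Suc K) h x \<partial>M) = lam * ((\<integral>\<^sup>+x. P r x \<partial>M) + (\<integral>\<^sup>+x. b x \<partial>M))"
    by (subst nn_integral_add[symmetric]) (auto intro!: arg_cong[where f = "\<lambda>z. lam * z"] nn_integral_cong simp: eq simp del: hit.simps)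
  also have "\<dots> = lam * (\<integral>\<^sup>+x. r x \<partial>M) + (\<integral>\<^sup>+x. lam * b x \<partial>M)"
    using nn_integral_Pn[of r 1] by (simp add: distrib_left nn_integral_cmult)
  also have "\<dots> \<le> (\<integral>\<^sup>+x. P h x * r x \<partial>M) + (\<integral>\<^sup>+x. h x * b x \<partial>M)"
    unfolding r_def by (intro add_mono Suc.IH nn_integral_mono) (auto simp: b_def intro: mult_right_mono)
  also have "\<dots> = (\<integral>\<^sup>+x. h x * P r x \<partial>M) + (\<integral>\<^sup>+x. h x * b x \<partial>M)"
    by (subst P_symmetric) auto
  also have "\<dots> = (\<integral>\<^sup>+x. h x * hit lam (Suc K) h x \<partial>M)"
    by (subst nn_integral_add[symmetric]) (auto intro!: nn_integral_cong simp: eq distrib_left simp del: hit.simps)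
  finally show ?case .
qed

lemma nn_integral_hit_le':
  assumes [measurable]: "h \<in> borel_measurable M"
  shows "lam * (\<integral>\<^sup>+x. hit lam K h x \<partial>M) \<le> (\<integral>\<^sup>+x. h x \<partial>M)"
proof -
  have "h x * hit lam K h x \<le> h x * 1" if "x \<in> space M" for x
    by (intro mult_left_mono hit_le_1 that) auto
  then have "(\<integral>\<^sup>+x. h x * hit lam K h x \<partial>M) \<le> (\<integral>\<^sup>+x. h x \<partial>M)"
    by (intro nn_integral_mono) simp
  with nn_integral_hit_le[OF assms] show ?thesis by (rule order_trans)
qed

text \<open>The left side is the probability of an exceedance at the single time \<open>m\<close>,
  one of the events that \<open>hit\<close> unites.\<close>

lemma Pn_superlevel_le_hit:
  "m \<le> K \<Longrightarrow> h \<in> borel_measurable M \<Longrightarrow> x \<in> space M \<Longrightarrow>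
    Pn m (\<lambda>y. if Pn m h y > lam then 1 else 0) x \<le> hit lam K h x"
proof (induction K arbitrary: m h x)
  case (Suc K)
  note [measurable] = Suc.prems(2)
  show ?case
  proof (cases m)
    case (Suc j)
    have "Pn m (\<lambda>y. if Pn m h y > lam then 1 else 0) x
        = P (Pn j (\<lambda>y. if Pn j (P h) y > lam then 1 else 0)) x"
      by (simp add: Suc funpow_swap1)
    also have "\<dots> \<le> P (hit lam K (P h)) x"
      using Suc.prems Suc by (intro P_mono Suc.IH) auto
    also have "\<dots> \<le> hit lam (Suc K) h x"
    proof -
      have "P (hit lam K (P h)) x \<le> P (\<lambda>_. 1) x" by (intro P_mono hit_le_1)
      then show ?thesis using Suc.prems by (auto simp: P_const)
    qed
    finally show ?thesis .
  qed simp
qed simp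

text \<open>Writing \<open>P\<^sup>2\<^sup>m h = P\<^sup>m (P\<^sup>m h)\<close> and cutting the
  inner function into dyadic layers leaves hit probabilities. Each of the \<open>J\<close> layers
  costs one integral of \<open>h\<close> by Doob's inequality; what lies below level 1 goes into the
  additive 1. The bound for \<open>H\<close> does not depend on \<open>K\<close>.\<close>

lemma Rota_maximal:
  assumes [measurable]: "h \<in> borel_measurable M" and bound: "\<And>x. x \<in> space M \<Longrightarrow> h x \<le> 2 ^ J"
  obtains H where "H \<in> borel_measurable M" "(\<integral>\<^sup>+x. H x \<partial>M) \<le> of_nat J * (\<integral>\<^sup>+x. h x \<partial>M)"
    "\<And>m x. m \<le> K \<Longrightarrow> x \<in> space M \<Longrightarrow> Pn (2 * m) h x \<le> 1 + H x"
proof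
  define H where "H x = (\<Sum>i<J. 2 ^ i * hit (2 ^ i) K h x)" for x
  show "H \<in> borel_measurable M" unfolding H_def by measurable
  have "(\<integral>\<^sup>+x. H x \<partial>M) = (\<Sum>i<J. 2 ^ i * (\<integral>\<^sup>+x. hit (2 ^ i) K h x \<partial>M))"
    unfolding H_def by (subst nn_integral_sum) (auto simp: nn_integral_cmult)
  also have "\<dots> \<le> (\<Sum>i<J. \<integral>\<^sup>+x. h x \<partial>M)"
    by (intro sum_mono nn_integral_hit_le') auto
  finally show "(\<integral>\<^sup>+x. H x \<partial>M) \<le> of_nat J * (\<integral>\<^sup>+x. h x \<partial>M)" by simp
  fix m x assume m: "m \<le> K" and x: "x \<in> space M"
  have le: "Pn m h y \<le> 2 ^ J" if "y \<in> space M" for y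
    using Pn_mono[of h "\<lambda>_. 2 ^ J" y m] that bound by (simp add: Pn_const)
  have "Pn (2 * m) h x = Pn m (Pn m h) x"
    by (simp add: mult_2 funpow_add)
  also have "\<dots> \<le> Pn m (\<lambda>y. 1 + (\<Sum>i<J. 2 ^ i * (if Pn m h y > 2 ^ i then 1 else 0))) x"
    by (intro Pn_mono dyadic_layers le x)
  also have "\<dots> = 1 + (\<Sum>i<J. 2 ^ i * Pn m (\<lambda>y. if Pn m h y > 2 ^ i then 1 else 0) x)"
    using x by (simp add: Pn_add Pn_const Pn_sum Pn_cmult)
  also have "\<dots> \<le> 1 + H x"
    unfolding H_def using m x by (intro add_mono sum_mono mult_left_mono Pn_superlevel_le_hit) auto
  finally show "Pn (2 * m) h x \<le> 1 + H x" .
qed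

subsection \<open>The Hopf maximal inequality\<close>

text \<open>
  Subtraction in \<open>ennreal\<close> is truncated at 0, so the recursion is Hopf's \<open>max 0 (f + P B - 1)\<close>.
\<close>

primrec excess :: "('a \<Rightarrow> ennreal) \<Rightarrow> nat \<Rightarrow> 'a \<Rightarrow> ennreal" where
  "excess f 0 = (\<lambda>_. 0)"
| "excess f (Suc N) = (\<lambda>x. (f x + P (excess f N) x) - 1)"

lemma excess_measurable [measurable]:
  "f \<in> borel_measurable M \<Longrightarrow> excess f N \<in> borel_measurable M"
  by (induction N) auto

lemma excess_mono: "excess f N x \<le> excess f (Suc N) x"
proof (induction N arbitrary: x)
  case (Suc N)
  have "P (excess f N) x \<le> P (excess f (Suc N)) x" by (intro P_mono Suc)
  then show ?case by (auto intro!: ennreal_minus_mono add_left_mono)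
qed simp

text \<open>A crude bound, wanted only for finiteness: it permits a cancellation in Hopf's
  argument.\<close>

lemma nn_integral_excess_le:
  assumes [measurable]: "f \<in> borel_measurable M"
  shows "(\<integral>\<^sup>+x. excess f N x \<partial>M) \<le> of_nat N * (\<integral>\<^sup>+x. f x \<partial>M)"
proof (induction N)
  case (Suc N)
  have "(\<integral>\<^sup>+x. excess f (Suc N) x \<partial>M) \<le> (\<integral>\<^sup>+x. f x + P (excess f N) x \<partial>M)"
    by (intro nn_integral_mono) (simp add: ennreal_diff_le_mono_left)
  also have "\<dots> = (\<integral>\<^sup>+x. f x \<partial>M) + (\<integral>\<^sup>+x. excess f N x \<partial>M)"
    using nn_integral_Pn[of "excess f N" 1] by (simp add: nn_integral_add)
  also have "\<dots> \<le> (\<integral>\<^sup>+x. f x \<partial>M) + of_nat N * (\<integral>\<^sup>+x. f x \<partial>M)"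
    by (intro add_left_mono Suc)
  finally show ?case by (simp add: distrib_right)
qed simp

text \<open>Where the excess is positive, adding 1 undoes the subtraction in its recursion. On
  integration, \<open>P\<close> preserves the integral of the previous excess, which is at most the
  current one and therefore cancels.\<close>

lemma emeasure_excess_le:
  assumes [measurable]: "f \<in> borel_measurable M"
  shows "emeasure M {x \<in> space M. excess f N x > 0} \<le> (\<integral>\<^sup>+x. f x \<partial>M)"
proof (cases "(\<integral>\<^sup>+x. f x \<partial>M) = top \<or> N = 0")
  case False
  then obtain j where N: "N = Suc j" by (cases N) auto
  define S where "S = {x \<in> space M. excess f N x > 0}"
  have [measurable]: "S \<in> sets M" unfolding S_def by measurable
  have fin: "(\<integral>\<^sup>+x. excess f j x \<partial>M) < top"
    by (rule le_less_trans[OF nn_integral_excess_le[OF assms]])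
      (use False in \<open>simp add: ennreal_mult_eq_top_iff less_top[symmetric]\<close>)
  have "(\<integral>\<^sup>+x. excess f j x \<partial>M) + emeasure M S \<le> (\<integral>\<^sup>+x. excess f N x \<partial>M) + emeasure M S"
    unfolding N by (intro add_right_mono nn_integral_mono excess_mono)
  also have "\<dots> = (\<integral>\<^sup>+x. excess f N x + indicator S x \<partial>M)"
    by (subst nn_integral_add) auto
  also have "\<dots> \<le> (\<integral>\<^sup>+x. f x + P (excess f j) x \<partial>M)"
  proof (intro nn_integral_mono)
    fix x assume "x \<in> space M"
    show "excess f N x + indicator S x \<le> f x + P (excess f j) x"
    proof (cases "x \<in> S")
      case True
      then have "f x + P (excess f j) x > 1"
        unfolding S_def N by (simp add: diff_gt_0_iff_gt_ennreal)
      then show ?thesis using True diff_add_cancel_ennreal[of 1 "f x + P (excess f j) x"]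
        by (simp add: N)
    next
      case False
      then have "excess f N x = 0" using \<open>x \<in> space M\<close> by (auto simp: S_def)
      with False show ?thesis by simp
    qed
  qed
  also have "\<dots> = (\<integral>\<^sup>+x. excess f j x \<partial>M) + (\<integral>\<^sup>+x. f x \<partial>M)"
    using nn_integral_Pn[of "excess f j" 1] by (simp add: nn_integral_add add.commute)
  finally show ?thesis using fin by (simp add: ennreal_add_left_cancel_le S_def less_top[symmetric])
qed auto

text \<open>When the recursion is unrolled, each of the \<open>N\<close> truncated subtractions
  removes at most 1.\<close>

lemma sum_Pn_le_excess:
  assumes [measurable]: "f \<in> borel_measurable M"
  shows "x \<in> space M \<Longrightarrow> (\<Sum>m<N. Pn m f x) \<le> excess f N x + of_nat N"
proof (induction N arbitrary: x)
  case (Suc N)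
  have "(\<Sum>m<Suc N. Pn m f x) = f x + (\<Sum>m<N. Pn (Suc m) f x)"
    by (subst sum.lessThan_Suc_shift) simp
  also have "(\<Sum>m<N. Pn (Suc m) f x) = P (\<lambda>y. \<Sum>m<N. Pn m f y) x"
    using Pn_sum[of "{..<N}" "\<lambda>m. Pn m f" x 1] Suc.prems by simp
  also have "P (\<lambda>y. \<Sum>m<N. Pn m f y) x \<le> P (\<lambda>y. excess f N y + of_nat N) x"
    by (intro P_mono Suc.IH)
  also have "\<dots> = P (excess f N) x + of_nat N"
    using Suc.prems by (simp add: P_add P_const)
  finally have "(\<Sum>m<Suc N. Pn m f x) \<le> (f x + P (excess f N) x) + of_nat N"
    by (simp add: add_mono add.assoc)
  also have "f x + P (excess f N) x \<le> excess f (Suc N) x + 1"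
    using le_minus_add by simp
  finally show ?case by (simp add: add.assoc)
qed simp

lemma Hopf_maximal:
  assumes [measurable]: "f \<in> borel_measurable M"
  shows "emeasure M {x \<in> space M. \<exists>N\<le>K. (\<Sum>m<N. Pn m f x) > of_nat N} \<le> (\<integral>\<^sup>+x. f x \<partial>M)"
proof -
  have "emeasure M {x \<in> space M. \<exists>N\<le>K. (\<Sum>m<N. Pn m f x) > of_nat N}
      \<le> emeasure M {x \<in> space M. excess f K x > 0}"
  proof (intro emeasure_mono, safe)
    fix x N assume x: "x \<in> space M" and N: "N \<le> K" and gt: "(\<Sum>m<N. Pn m f x) > of_nat N"
    have "excess f N x > 0"
      using sum_Pn_le_excess[OF assms x, of N] gt by (cases "excess f N x = 0") (auto simp: zero_less_iff_neq_zero)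
    moreover have "excess f N x \<le> excess f K x"
      by (rule lift_Suc_mono_le[OF _ N]) (rule excess_mono)
    ultimately show "excess f K x > 0" by order
  qed measurable
  also have "\<dots> \<le> (\<integral>\<^sup>+x. f x \<partial>M)" by (rule emeasure_excess_le[OF assms])
  finally show ?thesis .
qed

subsection \<open>Maximal inequality for dyadic times\<close>

text \<open>The defect in Jensen's inequality. For measurable \<open>g\<close>,
  \<open>Pn_min_le\<close> ensures that the subtraction is not truncated at points of the
  space.\<close>

definition jensen_gap :: "nat \<Rightarrow> ennreal \<Rightarrow> ('a \<Rightarrow> ennreal) \<Rightarrow> 'a \<Rightarrow> ennreal" where
  "jensen_gap s c g x = min (Pn s g x) c - Pn s (\<lambda>y. min (g y) c) x"

lemma jensen_gap_measurable [measurable]: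
  assumes [measurable]: "g \<in> borel_measurable M"
  shows "jensen_gap s c g \<in> borel_measurable M"
  unfolding jensen_gap_def[abs_def] by measurable

lemma jensen_gap_add:
  assumes "g \<in> borel_measurable M" "x \<in> space M"
  shows "Pn s (\<lambda>y. min (g y) c) x + jensen_gap s c g x = min (Pn s g x) c"
  unfolding jensen_gap_def using Pn_min_le[OF assms] by (subst add.commute) (rule diff_add_cancel_ennreal)

text \<open>As \<open>Pn s\<close> preserves the integral of the truncation, the mass of the gap is
  the growth of the truncated mass, so the gaps of successive steps telescope. The additive form
  avoids subtracting infinite integrals.\<close>

lemma nn_integral_jensen_gap:
  assumes [measurable]: "g \<in> borel_measurable M"
  shows "(\<integral>\<^sup>+x. jensen_gap s c g x \<partial>M) + (\<integral>\<^sup>+x. min (g x) c \<partial>M) = (\<integral>\<^sup>+x. min (Pn s g x) c \<partial>M)"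
proof -
  have "(\<integral>\<^sup>+x. min (Pn s g x) c \<partial>M) = (\<integral>\<^sup>+x. Pn s (\<lambda>y. min (g y) c) x + jensen_gap s c g x \<partial>M)"
    by (intro nn_integral_cong jensen_gap_add[symmetric]) auto
  also have "\<dots> = (\<integral>\<^sup>+x. Pn s (\<lambda>y. min (g y) c) x \<partial>M) + (\<integral>\<^sup>+x. jensen_gap s c g x \<partial>M)"
    by (rule nn_integral_add) measurable
  also have "(\<integral>\<^sup>+x. Pn s (\<lambda>y. min (g y) c) x \<partial>M) = (\<integral>\<^sup>+x. min (g x) c \<partial>M)"
    by (rule nn_integral_Pn) measurable
  finally show ?thesis by (simp add: add.commute)
qed

text \<open>A potential that never decreases along the semigroup and stays below six integrals. Its
  levels 32 and 20 are those of the gaps in \<open>no_sudden_drop\<close>, and its weights 2 and 4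
  are what the function \<open>U\<close> there costs.\<close>

definition trunc_mass :: "('a \<Rightarrow> ennreal) \<Rightarrow> ennreal" where
  "trunc_mass g = 2 * (\<integral>\<^sup>+x. min (g x) 32 \<partial>M) + 4 * (\<integral>\<^sup>+x. min (g x) 20 \<partial>M)"

lemma trunc_mass_le: "trunc_mass g \<le> 6 * (\<integral>\<^sup>+x. g x \<partial>M)"
proof -
  have "trunc_mass g \<le> 2 * (\<integral>\<^sup>+x. g x \<partial>M) + 4 * (\<integral>\<^sup>+x. g x \<partial>M)"
    unfolding trunc_mass_def by (intro add_mono mult_left_mono nn_integral_mono) auto
  then show ?thesis by (simp add: distrib_right[symmetric])
qed

lemma trunc_mass_mono:
  assumes [measurable]: "g \<in> borel_measurable M"
  shows "trunc_mass g \<le> trunc_mass (Pn s g)"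
  unfolding trunc_mass_def nn_integral_jensen_gap[OF assms, symmetric]
  by (intro add_mono mult_left_mono) (auto simp: add_increasing)

text \<open>
  Go from \<open>x\<close> one step \<open>P\<^sup>s\<close> to \<open>X\<close> and another one to \<open>X'\<close>.  If \<open>P\<^sup>s g x \<ge> 32\<close>, then the gap at
  level 32 controls the probability that \<open>g X < 24\<close>, and by reversibility the gap at level 20
  controls the average over \<open>x\<close> of the probability that \<open>g X \<ge> 24\<close> and \<open>P\<^sup>s g X' \<le> 16\<close>.
  Otherwise \<open>P\<^sup>s g X' > 16\<close>, which bounds \<open>P\<^sup>2\<^sup>s (P\<^sup>s g) x\<close> from below.
\<close>

lemma no_sudden_drop:
  assumes [measurable]: "g \<in> borel_measurable M"
  obtains U where "U \<in> borel_measurable M" "(\<integral>\<^sup>+x. U x \<partial>M) + trunc_mass g \<le> trunc_mass (Pn s g)"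
    "\<And>x. x \<in> space M \<Longrightarrow> 32 \<le> Pn s g x \<Longrightarrow> 16 \<le> U x + Pn s (Pn s (Pn s g)) x"
proof
  define lo where "lo y = (if g y < 24 then 1 else 0 :: ennreal)" for y
  define hi where "hi y = (if g y < 24 then 0 else 1 :: ennreal)" for y
  define lo' where "lo' y = (if Pn s g y \<le> 16 then 1 else 0 :: ennreal)" for y
  define hi' where "hi' y = (if Pn s g y \<le> 16 then 0 else 1 :: ennreal)" for y
  have [measurable]: "lo \<in> borel_measurable M" "hi \<in> borel_measurable M"
    "lo' \<in> borel_measurable M" "hi' \<in> borel_measurable M"
    unfolding lo_def hi_def lo'_def hi'_def by measurable
  define Q where "Q x = Pn s (\<lambda>y. hi y * Pn s lo' y) x" for x
  have [measurable]: "Q \<in> borel_measurable M" unfolding Q_def by measurable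
  \<comment> \<open>Where \<open>Pn s g x \<ge> 32\<close>, the gap at level 32 is at least 8 times
    the probability of \<open>g < 24\<close>, so weight 2 yields the required 16. The second term is
    paid for by four gaps at level 20.\<close>
  define U where "U x = 2 * jensen_gap s 32 g x + 16 * Q x" for x
  show "U \<in> borel_measurable M" unfolding U_def by measurable
  have "4 * (\<integral>\<^sup>+x. Q x \<partial>M) = 4 * (\<integral>\<^sup>+x. hi x * Pn s lo' x \<partial>M)"
    unfolding Q_def by (subst nn_integral_Pn) auto
  also have "\<dots> = 4 * (\<integral>\<^sup>+x. Pn s hi x * lo' x \<partial>M)"
    by (subst Pn_symmetric) auto
  also have "\<dots> = (\<integral>\<^sup>+x. 4 * (Pn s hi x * lo' x) \<partial>M)"
    by (rule nn_integral_cmult[symmetric]) measurable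
  also have "\<dots> \<le> (\<integral>\<^sup>+x. jensen_gap s 20 g x \<partial>M)"
  proof (intro nn_integral_mono)
    fix x assume x: "x \<in> space M"
    show "4 * (Pn s hi x * lo' x) \<le> jensen_gap s 20 g x"
    proof (cases "Pn s g x \<le> 16")
      case True
      \<comment> \<open>A value of at least 24 loses at least 4 by truncation at 20. As
        \<open>Pn s g x\<close> is itself below 20, all of this loss shows up in the gap.\<close>
      have "Pn s (\<lambda>y. min (g y) 20 + 4 * hi y) x \<le> Pn s g x"
        by (intro Pn_mono x) (auto simp: hi_def min_def not_less dest: order_trans[of 24 _ 20])
      then have le: "Pn s (\<lambda>y. min (g y) 20) x + 4 * Pn s hi x \<le> Pn s g x"
        using x by (simp add: Pn_add Pn_cmult)
      moreover have "Pn s g x = Pn s (\<lambda>y. min (g y) 20) x + jensen_gap s 20 g x"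
        using True by (subst jensen_gap_add[OF assms x]) (auto simp: min_def intro: order_trans)
      moreover have "Pn s (\<lambda>y. min (g y) 20) x \<noteq> top"
        using le True by (auto simp: top_unique)
      ultimately show ?thesis using True by (simp add: ennreal_add_left_cancel_le lo'_def)
    qed (simp add: lo'_def)
  qed
  finally have Q_le: "4 * (\<integral>\<^sup>+x. Q x \<partial>M) \<le> (\<integral>\<^sup>+x. jensen_gap s 20 g x \<partial>M)" .
  have "(\<integral>\<^sup>+x. U x \<partial>M) + trunc_mass g
      = 2 * (\<integral>\<^sup>+x. jensen_gap s 32 g x \<partial>M) + 4 * (4 * (\<integral>\<^sup>+x. Q x \<partial>M)) + trunc_mass g"
    unfolding U_def by (simp add: nn_integral_add nn_integral_cmult mult.assoc[symmetric])
  also have "\<dots> \<le> 2 * (\<integral>\<^sup>+x. jensen_gap s 32 g x \<partial>M) + 4 * (\<integral>\<^sup>+x. jensen_gap s 20 g x \<partial>M) + trunc_mass g"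
    by (intro add_mono mult_left_mono Q_le) auto
  also have "\<dots> = trunc_mass (Pn s g)"
    unfolding trunc_mass_def nn_integral_jensen_gap[OF assms, symmetric]
    by (simp add: distrib_left ac_simps)
  finally show "(\<integral>\<^sup>+x. U x \<partial>M) + trunc_mass g \<le> trunc_mass (Pn s g)" .
  fix x assume x: "x \<in> space M" and ge: "32 \<le> Pn s g x"
  \<comment> \<open>Values below 24 stay 8 short of the cap 32.\<close>
  have "Pn s (\<lambda>y. min (g y) 32 + 8 * lo y) x \<le> Pn s (\<lambda>_. 32) x"
  proof (intro Pn_mono x)
    fix y
    have "min (g y) 32 + 8 \<le> 24 + 8" if "g y < 24"
      using that by (intro add_right_mono) (simp add: min.coboundedI1 less_imp_le)
    then show "min (g y) 32 + 8 * lo y \<le> 32" by (auto simp: lo_def)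
  qed
  then have "Pn s (\<lambda>y. min (g y) 32) x + 8 * Pn s lo x \<le> 32"
    using x by (simp add: Pn_add Pn_cmult Pn_const)
  moreover have "32 = Pn s (\<lambda>y. min (g y) 32) x + jensen_gap s 32 g x"
    using ge by (subst jensen_gap_add[OF assms x]) auto
  moreover have "Pn s (\<lambda>y. min (g y) 32) x \<noteq> top"
    using Pn_min_le[OF assms x, of s 32] by (auto simp: top_unique)
  ultimately have lo_le: "8 * Pn s lo x \<le> jensen_gap s 32 g x"
    by (metis ennreal_add_left_cancel_le infinity_ennreal_def)
  have split: "lo y + (hi y * Pn s lo' y + Pn s hi' y) \<ge> 1" if y: "y \<in> space M" for y
  proof -
    have "(\<lambda>y. lo' y + hi' y) = (\<lambda>_. 1)" by (auto simp: lo'_def hi'_def)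
    with y have "1 = Pn s (\<lambda>y. lo' y + hi' y) y" by (simp add: Pn_const)
    also have "\<dots> = Pn s lo' y + Pn s hi' y"
      using y by (simp add: Pn_add)
    finally show ?thesis by (auto simp: lo_def hi_def)
  qed
  have "1 = Pn s (\<lambda>_. 1) x" using x by (simp add: Pn_const)
  also have "\<dots> \<le> Pn s (\<lambda>y. lo y + (hi y * Pn s lo' y + Pn s hi' y)) x"
    by (intro Pn_mono split x)
  also have "\<dots> = Pn s lo x + (Q x + Pn s (Pn s hi') x)"
    using x by (simp add: Pn_add Q_def)
  finally have "16 * 1 \<le> 16 * (Pn s lo x + (Q x + Pn s (Pn s hi') x))"
    by (intro mult_left_mono) auto
  also have "\<dots> = 2 * (8 * Pn s lo x) + 16 * Q x + Pn s (Pn s (\<lambda>y. 16 * hi' y)) x"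
  proof -
    have "Pn s (Pn s (\<lambda>y. 16 * hi' y)) x = Pn s (\<lambda>y. 16 * Pn s hi' y) x"
      by (intro antisym Pn_mono x) (auto simp: Pn_cmult)
    also have "\<dots> = 16 * Pn s (Pn s hi') x" using x by (simp add: Pn_cmult)
    finally show ?thesis by (simp add: distrib_left mult.assoc[symmetric] add.assoc)
  qed
  also have "\<dots> \<le> 2 * jensen_gap s 32 g x + 16 * Q x + Pn s (Pn s (Pn s g)) x"
    by (intro add_mono mult_left_mono lo_le Pn_mono x) (auto simp: hi'_def)
  finally show "16 \<le> U x + Pn s (Pn s (Pn s g)) x" by (simp add: U_def)
qed

text \<open>At a point where the value at time \<open>2 * S l\<close> is at least 32,
  \<open>no_sudden_drop\<close> is averaged over the steps \<open>s\<close> from 1 to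
  \<open>S l\<close>. Either the mean of \<open>U\<close> is at least 8, on a set \<open>A l\<close>
  whose measure is paid for by the growth of \<open>\<Phi>\<close> and hence summable over
  \<open>l\<close>; or a sum of \<open>Pn m f x\<close> over \<open>m\<close> exceeds the number of
  its terms, and Hopf's inequality applies.\<close>

lemma lacunary_maximal:
  assumes [measurable]: "f \<in> borel_measurable M" and \<sigma>: "\<sigma> > 0"
  shows "emeasure M {x \<in> space M. \<exists>l<R. 32 \<le> Pn (2 ^ Suc l * \<sigma>) f x} \<le> 2 * (\<integral>\<^sup>+x. f x \<partial>M)"
proof -
  define S where "S l = 2 ^ l * \<sigma>" for l
  have S_pos: "S l > 0" for l using \<sigma> by (simp add: S_def)
  have S_Suc: "S (Suc l) = 2 * S l" for l by (simp add: S_def)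
  define \<Phi> where "\<Phi> l = trunc_mass (Pn (S l) f)" for l
  \<comment> \<open>Measurability stands outside the condition on \<open>s\<close>, so that the
    functions chosen are measurable for all \<open>s\<close>; for \<open>s > S l\<close> the zero
    function serves.\<close>
  define good where "good l s U \<longleftrightarrow> U \<in> borel_measurable M \<and> (s \<le> S l \<longrightarrow>
      (\<integral>\<^sup>+x. U x \<partial>M) + \<Phi> l \<le> \<Phi> (Suc l) \<and>
      (\<forall>x \<in> space M. 32 \<le> Pn (S (Suc l)) f x \<longrightarrow> 16 \<le> U x + Pn (S (Suc l) + 2 * s) f x))" for l s U
  have "\<exists>U. good l s U" for l s
  proof (cases "s \<le> S l")
    case True
    \<comment> \<open>The step of length \<open>s\<close> ends at time \<open>S (Suc l)\<close>.
      Since \<open>s \<le> S l\<close>, it starts no earlier than \<open>S l\<close>, so what it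
      adds to the potential is part of the growth from \<open>\<Phi> l\<close> to
      \<open>\<Phi> (Suc l)\<close>.\<close>
    define g where "g = Pn (S (Suc l) - s) f"
    have [measurable]: "g \<in> borel_measurable M" unfolding g_def by measurable
    have g: "Pn s g = Pn (S (Suc l)) f"
      unfolding g_def using True by (simp add: S_Suc Pn_Pn)
    have g2: "Pn s (Pn s (Pn s g)) = Pn (S (Suc l) + 2 * s) f"
      unfolding g by (simp add: Pn_Pn mult_2 add.assoc add.commute add.left_commute)
    have g0: "g = Pn (S l - s) (Pn (S l) f)"
      unfolding g_def using True by (simp add: S_Suc Pn_Pn mult_2)
    obtain U where [measurable]: "U \<in> borel_measurable M"
      and 1: "(\<integral>\<^sup>+x. U x \<partial>M) + trunc_mass g \<le> trunc_mass (Pn s g)"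
      and 2: "\<And>x. x \<in> space M \<Longrightarrow> 32 \<le> Pn s g x \<Longrightarrow> 16 \<le> U x + Pn s (Pn s (Pn s g)) x"
      using no_sudden_drop[of g s] by auto
    have "\<Phi> l \<le> trunc_mass g"
      unfolding \<Phi>_def g0 by (intro trunc_mass_mono) auto
    with 1 have "(\<integral>\<^sup>+x. U x \<partial>M) + \<Phi> l \<le> \<Phi> (Suc l)"
      unfolding \<Phi>_def g using add_left_mono order_trans by blast
    with 2 show ?thesis by (intro exI[of _ U]) (auto simp: good_def g2[unfolded g] g)
  qed (auto simp: good_def intro: exI[of _ "\<lambda>_. 0"])
  then obtain U where "\<And>l s. good l s (U l s)" by metis
  then have U_meas [measurable]: "\<And>l s. U l s \<in> borel_measurable M"
    and U_int: "\<And>l s. s \<le> S l \<Longrightarrow> (\<integral>\<^sup>+x. U l s x \<partial>M) + \<Phi> l \<le> \<Phi> (Suc l)"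
    and U_ge: "\<And>l s x. s \<le> S l \<Longrightarrow> x \<in> space M \<Longrightarrow> 32 \<le> Pn (S (Suc l)) f x \<Longrightarrow>
        16 \<le> U l s x + Pn (S (Suc l) + 2 * s) f x"
    by (auto simp: good_def)
  define V where "V l x = (\<Sum>s=1..S l. U l s x)" for l x
  have [measurable]: "V l \<in> borel_measurable M" for l unfolding V_def by measurable
  define A where "A l = {x \<in> space M. 8 * of_nat (S l) \<le> V l x}" for l
  have [measurable]: "A l \<in> sets M" for l unfolding A_def by measurable
  have A_le: "8 * emeasure M (A l) + \<Phi> l \<le> \<Phi> (Suc l)" for l
  proof -
    have "(8 * of_nat (S l)) * emeasure M (A l) = (\<integral>\<^sup>+x. (8 * of_nat (S l)) * indicator (A l) x \<partial>M)"
      by (simp add: nn_integral_cmult)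
    also have "\<dots> \<le> (\<integral>\<^sup>+x. V l x \<partial>M)"
      by (intro nn_integral_mono) (auto simp: A_def indicator_def)
    also have "\<dots> = (\<Sum>s=1..S l. \<integral>\<^sup>+x. U l s x \<partial>M)"
      unfolding V_def by (rule nn_integral_sum) measurable
    finally have "of_nat (S l) * (8 * emeasure M (A l) + \<Phi> l) \<le> (\<Sum>s=1..S l. (\<integral>\<^sup>+x. U l s x \<partial>M) + \<Phi> l)"
      by (simp add: sum.distrib distrib_left ac_simps add_right_mono)
    also have "\<dots> \<le> (\<Sum>s=1..S l. \<Phi> (Suc l))"
      by (intro sum_mono U_int) auto
    finally show ?thesis
      using S_pos[of l] by (simp add: ennreal_mult_le_mult_iff)
  qed
  have sum_A: "8 * (\<Sum>l<R. emeasure M (A l)) + \<Phi> 0 \<le> \<Phi> R" for R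
  proof (induction R)
    case (Suc R)
    have "8 * (\<Sum>l<Suc R. emeasure M (A l)) + \<Phi> 0 = 8 * emeasure M (A R) + (8 * (\<Sum>l<R. emeasure M (A l)) + \<Phi> 0)"
      by (simp add: distrib_left ac_simps)
    also have "\<dots> \<le> 8 * emeasure M (A R) + \<Phi> R" by (intro add_left_mono Suc)
    finally show ?case using A_le[of R] by order
  qed simp
  \<comment> \<open>The averages used below have \<open>4 * S l + 1\<close> terms with
    \<open>l < R\<close>: the latest time is \<open>S (Suc l) + 2 * S l = 4 * S l\<close>, and time
    0 counts.\<close>
  define K where "K = 4 * S R + 1"
  define B where "B = {x \<in> space M. \<exists>N\<le>K. (\<Sum>m<N. Pn m f x) > of_nat N}"
  have [measurable]: "B \<in> sets M" unfolding B_def by measurable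
  have sub: "{x \<in> space M. \<exists>l<R. 32 \<le> Pn (2 ^ Suc l * \<sigma>) f x} \<subseteq> (\<Union>l<R. A l) \<union> B"
  proof safe
    fix x l assume x: "x \<in> space M" and l: "l < R" and "32 \<le> Pn (2 ^ Suc l * \<sigma>) f x"
      and nB: "x \<notin> B"
    then have ge: "32 \<le> Pn (S (Suc l)) f x" by (simp add: S_def)
    have "(\<Sum>s=1..S l. 16) \<le> (\<Sum>s=1..S l. U l s x + Pn (S (Suc l) + 2 * s) f x)"
      by (intro sum_mono U_ge x ge) auto
    then have le: "16 * of_nat (S l) \<le> V l x + (\<Sum>s=1..S l. Pn (S (Suc l) + 2 * s) f x)"
      by (simp add: sum.distrib V_def mult.commute)
    have "(\<Sum>s=1..S l. Pn (S (Suc l) + 2 * s) f x) = (\<Sum>m\<in>(\<lambda>s. S (Suc l) + 2 * s) ` {1..S l}. Pn m f x)"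
      by (subst sum.reindex) (auto simp: inj_on_def)
    also have "\<dots> \<le> (\<Sum>m<4 * S l + 1. Pn m f x)"
      by (intro sum_mono2) (auto simp: S_Suc)
    also have "\<dots> \<le> of_nat (4 * S l + 1)"
    proof -
      have "4 * S l + 1 \<le> 4 * S R + 1" unfolding S_def using l by (simp add: power_increasing)
      moreover have "\<forall>N\<le>K. (\<Sum>m<N. Pn m f x) \<le> of_nat N" using nB x by (auto simp: B_def not_less)
      ultimately show ?thesis by (auto simp only: K_def)
    qed
    also have "\<dots> \<le> of_nat (8 * S l)"
      using S_pos[of l] by (subst of_nat_le_iff) linarith
    finally have "16 * of_nat (S l) \<le> V l x + 8 * of_nat (S l)"
      using le add_left_mono order_trans by fastforce
    moreover have "16 * of_nat (S l) = 8 * of_nat (S l) + 8 * (of_nat (S l) :: ennreal)"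
      by (simp flip: distrib_right)
    ultimately have "8 * of_nat (S l) + 8 * of_nat (S l) \<le> 8 * of_nat (S l) + V l x"
      by (simp only: add.commute)
    then have "x \<in> A l"
      using x by (simp add: A_def ennreal_add_left_cancel_le ennreal_mult_eq_top_iff)
    then show "x \<in> (\<Union>l<R. A l)" using l by auto
  qed
  have "emeasure M {x \<in> space M. \<exists>l<R. 32 \<le> Pn (2 ^ Suc l * \<sigma>) f x} \<le> emeasure M ((\<Union>l<R. A l) \<union> B)"
    by (intro emeasure_mono sub) measurable
  also have "\<dots> \<le> (\<Sum>l<R. emeasure M (A l)) + emeasure M B"
    by (intro order_trans[OF emeasure_subadditive] add_right_mono emeasure_subadditive_finite) auto
  also have "\<dots> \<le> (\<integral>\<^sup>+x. f x \<partial>M) + (\<integral>\<^sup>+x. f x \<partial>M)"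
  proof (intro add_mono)
    have "8 * (\<Sum>l<R. emeasure M (A l)) \<le> \<Phi> R"
      by (rule order_trans[OF _ sum_A]) (simp add: le_iff_add)
    also have "\<dots> \<le> 6 * (\<integral>\<^sup>+x. Pn (S R) f x \<partial>M)"
      unfolding \<Phi>_def by (rule trunc_mass_le)
    also have "\<dots> = 6 * (\<integral>\<^sup>+x. f x \<partial>M)" by (simp add: nn_integral_Pn)
    also have "\<dots> \<le> 8 * (\<integral>\<^sup>+x. f x \<partial>M)" by (intro mult_right_mono) auto
    finally show "(\<Sum>l<R. emeasure M (A l)) \<le> (\<integral>\<^sup>+x. f x \<partial>M)"
      by (simp add: ennreal_mult_le_mult_iff)
    show "emeasure M B \<le> (\<integral>\<^sup>+x. f x \<partial>M)" unfolding B_def by (rule Hopf_maximal) measurable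
  qed
  finally show ?thesis by (simp add: mult_2)
qed

subsection \<open>Maximal inequality for all times\<close>

text \<open>Iterating one step, the truncated evolution is the evolution of its initial value plus
  those of the gaps created on the way. Each gap gets its own Rota majorant: at most
  \<open>N\<close> additive errors 1 give \<open>of_nat N\<close>, the cap \<open>2 ^ a\<close>
  gives the factor \<open>a\<close>, and the gap integrals telescope, within the octave and from one
  octave to the next.\<close>

lemma octave_decomposition:
  assumes [measurable]: "f \<in> borel_measurable M"
  obtains G where "G \<in> borel_measurable M"
    "(\<integral>\<^sup>+x. G x \<partial>M) + of_nat a * (\<integral>\<^sup>+x. min (Pn (2 ^ Suc l * N) f x) (2 ^ a) \<partial>M)
      \<le> of_nat a * (\<integral>\<^sup>+x. min (Pn (2 ^ Suc (Suc l) * N) f x) (2 ^ a) \<partial>M)"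
    "\<And>x i. x \<in> space M \<Longrightarrow> i \<le> N \<Longrightarrow> min (Pn (2 ^ Suc l * (N + i)) f x) (2 ^ a)
      \<le> Pn (2 * (2 ^ l * i)) (\<lambda>y. min (Pn (2 ^ Suc l * N) f y) (2 ^ a)) x + of_nat N + G x"
proof -
  define T where "T i = 2 ^ Suc l * (N + i)" for i
  define u :: nat where "u = 2 ^ Suc l"
  define w where "w i x = min (Pn (T i) f x) (2 ^ a)" for i x
  define J where "J i = jensen_gap u (2 ^ a) (Pn (T i) f)" for i
  have [measurable]: "w i \<in> borel_measurable M" "J i \<in> borel_measurable M" for i
    unfolding w_def J_def by measurable
  have T_Suc: "Pn u (Pn (T i) f) = Pn (T (Suc i)) f" for i
    unfolding Pn_Pn by (simp add: u_def T_def algebra_simps)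
  have w_Suc: "w (Suc i) x = Pn u (w i) x + J i x" if "x \<in> space M" for i x
    using jensen_gap_add[of "Pn (T i) f" x u "2 ^ a"] that by (simp add: w_def[abs_def] J_def T_Suc)
  have w_eq: "w i x = Pn (i * u) (w 0) x + (\<Sum>j<i. Pn ((i - Suc j) * u) (J j) x)"
    if "x \<in> space M" for i x
    using that
  proof (induction i arbitrary: x)
    case (Suc i)
    have "w (Suc i) x = Pn u (w i) x + J i x" by (rule w_Suc[OF Suc.prems])
    also have "Pn u (w i) x = Pn u (\<lambda>x. Pn (i * u) (w 0) x + (\<Sum>j<i. Pn ((i - Suc j) * u) (J j) x)) x"
      by (intro antisym Pn_mono Suc.prems) (auto simp: Suc.IH)
    also have "\<dots> = Pn (Suc i * u) (w 0) x + (\<Sum>j<i. Pn (u + (i - Suc j) * u) (J j) x)"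
      using Suc.prems by (simp add: Pn_add Pn_sum Pn_Pn)
    also have "(\<Sum>j<i. Pn (u + (i - Suc j) * u) (J j) x) = (\<Sum>j<i. Pn ((Suc i - Suc j) * u) (J j) x)"
      by (intro sum.cong refl) (auto simp: Suc_diff_Suc simp flip: mult_Suc)
    finally show ?case by (simp add: add.assoc)
  qed simp
  have J_le: "J i x \<le> 2 ^ a" for i x
    unfolding J_def jensen_gap_def by (simp add: ennreal_diff_le_mono_left)
  have "\<exists>H. H \<in> borel_measurable M \<and> (\<integral>\<^sup>+x. H x \<partial>M) \<le> of_nat a * (\<integral>\<^sup>+x. J i x \<partial>M) \<and>
      (\<forall>m x. m \<le> 2 ^ l * N \<longrightarrow> x \<in> space M \<longrightarrow> Pn (2 * m) (J i) x \<le> 1 + H x)" for i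
  proof -
    obtain H where "H \<in> borel_measurable M" "(\<integral>\<^sup>+x. H x \<partial>M) \<le> of_nat a * (\<integral>\<^sup>+x. J i x \<partial>M)"
      "\<And>m x. m \<le> 2 ^ l * N \<Longrightarrow> x \<in> space M \<Longrightarrow> Pn (2 * m) (J i) x \<le> 1 + H x"
      by (rule Rota_maximal[of "J i" a "2 ^ l * N"]) (auto intro: J_le)
    then show ?thesis by blast
  qed
  then obtain H where H_meas [measurable]: "\<And>i. H i \<in> borel_measurable M"
    and H_int: "\<And>i. (\<integral>\<^sup>+x. H i x \<partial>M) \<le> of_nat a * (\<integral>\<^sup>+x. J i x \<partial>M)"
    and H_ge: "\<And>i m x. m \<le> 2 ^ l * N \<Longrightarrow> x \<in> space M \<Longrightarrow> Pn (2 * m) (J i) x \<le> 1 + H i x"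
    by metis
  define G where "G x = (\<Sum>j<N. H j x)" for x
  show thesis
  proof
    show "G \<in> borel_measurable M" unfolding G_def by measurable
    have sum_J: "(\<Sum>j<i. \<integral>\<^sup>+x. J j x \<partial>M) + (\<integral>\<^sup>+x. w 0 x \<partial>M) = (\<integral>\<^sup>+x. w i x \<partial>M)" for i
    proof (induction i)
      case (Suc i)
      have "(\<Sum>j<Suc i. \<integral>\<^sup>+x. J j x \<partial>M) + (\<integral>\<^sup>+x. w 0 x \<partial>M)
          = (\<integral>\<^sup>+x. J i x \<partial>M) + ((\<Sum>j<i. \<integral>\<^sup>+x. J j x \<partial>M) + (\<integral>\<^sup>+x. w 0 x \<partial>M))"
        by (simp add: ac_simps)
      also have "\<dots> = (\<integral>\<^sup>+x. J i x \<partial>M) + (\<integral>\<^sup>+x. w i x \<partial>M)" by (simp only: Suc)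
      also have "\<dots> = (\<integral>\<^sup>+x. w (Suc i) x \<partial>M)"
        using nn_integral_jensen_gap[of "Pn (T i) f" u "2 ^ a"] by (simp add: w_def J_def T_Suc)
      finally show ?case .
    qed simp
    have "(\<integral>\<^sup>+x. G x \<partial>M) = (\<Sum>j<N. \<integral>\<^sup>+x. H j x \<partial>M)"
      unfolding G_def by (rule nn_integral_sum) measurable
    also have "\<dots> \<le> (\<Sum>j<N. of_nat a * (\<integral>\<^sup>+x. J j x \<partial>M))"
      by (intro sum_mono H_int)
    finally have "(\<integral>\<^sup>+x. G x \<partial>M) + of_nat a * (\<integral>\<^sup>+x. w 0 x \<partial>M)
        \<le> of_nat a * ((\<Sum>j<N. \<integral>\<^sup>+x. J j x \<partial>M) + (\<integral>\<^sup>+x. w 0 x \<partial>M))"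
      by (simp add: distrib_left sum_distrib_left add_right_mono)
    \<comment> \<open>The last point \<open>T N\<close> of this octave is the first point of the
      next one.\<close>
    then show "(\<integral>\<^sup>+x. G x \<partial>M) + of_nat a * (\<integral>\<^sup>+x. min (Pn (2 ^ Suc l * N) f x) (2 ^ a) \<partial>M)
      \<le> of_nat a * (\<integral>\<^sup>+x. min (Pn (2 ^ Suc (Suc l) * N) f x) (2 ^ a) \<partial>M)"
      unfolding sum_J unfolding w_def T_def by (simp add: mult_2[symmetric] mult.assoc)
    fix x i assume x: "x \<in> space M" and i: "i \<le> N"
    have "(\<Sum>j<i. Pn ((i - Suc j) * u) (J j) x) \<le> (\<Sum>j<i. 1 + H j x)"
    proof (intro sum_mono)
      fix j assume "j \<in> {..<i}"
      \<comment> \<open>Rota's bound concerns even times, and the step \<open>u = 2 * 2 ^ l\<close>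
        provides them.\<close>
      with i have "2 ^ l * (i - Suc j) \<le> 2 ^ l * N" by (intro mult_left_mono) auto
      from H_ge[OF this x, of j] show "Pn ((i - Suc j) * u) (J j) x \<le> 1 + H j x"
        by (simp add: u_def ac_simps)
    qed
    also have "\<dots> \<le> (\<Sum>j<N. 1 + H j x)"
      using i by (intro sum_mono2) auto
    also have "\<dots> = of_nat N + G x"
      by (simp add: sum.distrib G_def)
    finally have "w i x \<le> Pn (i * u) (w 0) x + (of_nat N + G x)"
      unfolding w_eq[OF x] by (intro add_left_mono)
    then show "min (Pn (2 ^ Suc l * (N + i)) f x) (2 ^ a)
      \<le> Pn (2 * (2 ^ l * i)) (\<lambda>y. min (Pn (2 ^ Suc l * N) f y) (2 ^ a)) x + of_nat N + G x"
      by (simp add: w_def[abs_def] T_def u_def ac_simps)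
  qed
qed

text \<open>With \<open>B = 2 ^ b \<ge> N\<close>, a value of at least \<open>4 * B\<close> leaves
  three cases' worth of budget: the error \<open>N\<close> takes at most \<open>B\<close>, the gap
  majorant takes less than \<open>B\<close> off the sets \<open>A' l\<close>, so at least
  \<open>2 * B\<close> comes from the start of the octave. As
  \<open>w l \<le> B + 4 * B * indicator D\<close>, the evolved indicator of \<open>D\<close> is
  then at least 1/4. Rota's bound for \<open>D\<close> makes this rare, \<open>D\<close> being small
  by \<open>lacunary_maximal\<close>.\<close>

lemma maximal_weak_type_power:
  assumes [measurable]: "f \<in> borel_measurable M" and N: "N > 0" "N \<le> 2 ^ b"
  shows "2 ^ b * emeasure M {x \<in> space M. \<exists>l<R. \<exists>i\<le>N. 4 * 2 ^ b \<le> Pn (2 ^ Suc l * (N + i)) f x}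
    \<le> of_nat (b + 1538) * (\<integral>\<^sup>+x. f x \<partial>M)"
proof -
  define B :: ennreal where "B = 2 ^ b"
  \<comment> \<open>Chosen so that the cap \<open>2 ^ a\<close> equals the threshold
    \<open>4 * B\<close>.\<close>
  define a where "a = b + 2"
  have A: "2 ^ a = 4 * B" by (simp add: a_def B_def)
  have B_fin: "B \<noteq> top" "B \<noteq> 0" by (auto simp: B_def power_eq_top_ennreal)
  have NB: "of_nat N \<le> B"
  proof -
    have "of_nat N \<le> (of_nat (2 ^ b) :: ennreal)" using N by (intro of_nat_mono)
    then show ?thesis by (simp add: B_def)
  qed
  define w where "w l x = min (Pn (2 ^ Suc l * N) f x) (2 ^ a)" for l x
  have [measurable]: "w l \<in> borel_measurable M" for l unfolding w_def by measurable
  have "\<exists>G. G \<in> borel_measurable M \<and>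
      (\<integral>\<^sup>+x. G x \<partial>M) + of_nat a * (\<integral>\<^sup>+x. w l x \<partial>M) \<le> of_nat a * (\<integral>\<^sup>+x. w (Suc l) x \<partial>M) \<and>
      (\<forall>x\<in>space M. \<forall>i\<le>N. min (Pn (2 ^ Suc l * (N + i)) f x) (2 ^ a)
        \<le> Pn (2 * (2 ^ l * i)) (w l) x + of_nat N + G x)" for l
    using octave_decomposition[of f a l N] assms(1) unfolding w_def[abs_def] by metis
  then obtain G where [measurable]: "\<And>l. G l \<in> borel_measurable M"
    and G_int: "\<And>l. (\<integral>\<^sup>+x. G l x \<partial>M) + of_nat a * (\<integral>\<^sup>+x. w l x \<partial>M) \<le> of_nat a * (\<integral>\<^sup>+x. w (Suc l) x \<partial>M)"
    and G_ge: "\<And>l x i. x \<in> space M \<Longrightarrow> i \<le> N \<Longrightarrow> min (Pn (2 ^ Suc l * (N + i)) f x) (2 ^ a)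
        \<le> Pn (2 * (2 ^ l * i)) (w l) x + of_nat N + G l x"
    by metis
  define D where "D = {x \<in> space M. \<exists>l<R. B \<le> Pn (2 ^ Suc l * N) f x}"
  have [measurable]: "D \<in> sets M" unfolding D_def by measurable
  \<comment> \<open>The factor 8 turns 1/4 into 2, which beats the additive 1 of Rota's bound;
    \<open>8 = 2 ^ 3\<close> needs three layers.\<close>
  obtain H where [measurable]: "H \<in> borel_measurable M"
    and H_int: "(\<integral>\<^sup>+x. H x \<partial>M) \<le> of_nat 3 * (\<integral>\<^sup>+x. 8 * indicator D x \<partial>M)"
    and H_ge: "\<And>m x. m \<le> 2 ^ R * N \<Longrightarrow> x \<in> space M \<Longrightarrow> Pn (2 * m) (\<lambda>x. 8 * indicator D x) x \<le> 1 + H x"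
    by (rule Rota_maximal[of "\<lambda>x. 8 * indicator D x" 3 "2 ^ R * N"]) (auto split: split_indicator)
  define A' where "A' l = {x \<in> space M. B \<le> G l x}" for l
  define E where "E = {x \<in> space M. 1 \<le> H x}"
  have [measurable]: "A' l \<in> sets M" "E \<in> sets M" for l unfolding A'_def E_def by measurable
  have sub: "{x \<in> space M. \<exists>l<R. \<exists>i\<le>N. 4 * 2 ^ b \<le> Pn (2 ^ Suc l * (N + i)) f x} \<subseteq> E \<union> (\<Union>l<R. A' l)"
  proof safe
    fix x l i assume x: "x \<in> space M" and l: "l < R" and i: "i \<le> N"
      and ge: "4 * 2 ^ b \<le> Pn (2 ^ Suc l * (N + i)) f x" and nA: "x \<notin> (\<Union>l<R. A' l)"
    have G: "G l x < B" using nA l x by (auto simp: A'_def not_le)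
    have "2 ^ l * i \<le> 2 ^ R * N" using l i by (intro mult_mono) (auto simp: power_increasing)
    note H = H_ge[OF this x]
    have "w l y \<le> B + 4 * B * indicator D y" if "y \<in> space M" for y
      using that l unfolding w_def A D_def by (auto simp: indicator_def min_def not_le intro: less_imp_le add_increasing)
    then have "Pn (2 * (2 ^ l * i)) (w l) x \<le> Pn (2 * (2 ^ l * i)) (\<lambda>y. B + 4 * B * indicator D y) x"
      by (intro Pn_mono x)
    also have "\<dots> = B + 4 * B * Pn (2 * (2 ^ l * i)) (indicator D) x"
      using x by (simp add: Pn_add Pn_const Pn_cmult)
    finally have Pw: "Pn (2 * (2 ^ l * i)) (w l) x \<le> B + 4 * B * Pn (2 * (2 ^ l * i)) (indicator D) x" .
    have "4 * B \<le> min (Pn (2 ^ Suc l * (N + i)) f x) (2 ^ a)"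
      using ge by (simp add: A B_def)
    also have "\<dots> \<le> Pn (2 * (2 ^ l * i)) (w l) x + of_nat N + G l x"
      by (rule G_ge[OF x i])
    also have "\<dots> \<le> (B + 4 * B * Pn (2 * (2 ^ l * i)) (indicator D) x) + B + B"
      using G by (intro add_mono Pw NB) auto
    finally have "2 * (4 * B) \<le> 2 * ((B + 4 * B * Pn (2 * (2 ^ l * i)) (indicator D) x) + B + B)"
      by (intro mult_left_mono) auto
    also have "\<dots> = B * (6 + 8 * Pn (2 * (2 ^ l * i)) (indicator D) x)"
    proof -
      have "B * 2 + (B * 2 + B * 2) = B * 6" by (simp add: distrib_left[symmetric])
      then show ?thesis by (simp add: distrib_left ac_simps)
    qed
    also have "8 * Pn (2 * (2 ^ l * i)) (indicator D) x = Pn (2 * (2 ^ l * i)) (\<lambda>y. 8 * indicator D y) x"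
      using x by (simp add: Pn_cmult)
    also have "\<dots> \<le> 1 + H x" by (rule H)
    finally have "B * 8 \<le> B * (6 + (1 + H x))"
      by (simp add: mult_left_mono mult.commute mult.left_commute)
    then have "7 + 1 \<le> 7 + H x"
      using B_fin by (simp add: ennreal_mult_le_mult_iff add.assoc[symmetric])
    then have "1 \<le> H x" by (simp only: ennreal_add_left_cancel_le) auto
    then show "x \<in> E" using x by (simp add: E_def)
  qed
  have BD: "B * emeasure M D \<le> 64 * (\<integral>\<^sup>+x. f x \<partial>M)"
  proof -
    \<comment> \<open>Rescales the threshold \<open>B\<close> to the 32 of
      \<open>lacunary_maximal\<close>.\<close>
    define r where "r = ennreal (32 / 2 ^ b)"
    have Br: "B * r = 32"
    proof -
      have "B = ennreal (2 ^ b)" by (simp add: B_def ennreal_power[symmetric])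
      then show ?thesis by (simp add: r_def ennreal_mult[symmetric])
    qed
    have "emeasure M D \<le> emeasure M {x \<in> space M. \<exists>l<R. 32 \<le> Pn (2 ^ Suc l * N) (\<lambda>x. r * f x) x}"
    proof (intro emeasure_mono, safe)
      fix x assume "x \<in> D"
      then obtain l where x: "x \<in> space M" "l < R" "B \<le> Pn (2 ^ Suc l * N) f x" by (auto simp: D_def)
      then have "32 \<le> r * Pn (2 ^ Suc l * N) f x"
        unfolding Br[symmetric] by (subst mult.commute) (intro mult_left_mono, auto)
      with x show "\<exists>l<R. 32 \<le> Pn (2 ^ Suc l * N) (\<lambda>x. r * f x) x" by (auto simp: Pn_cmult)
    qed (auto simp: D_def)
    also have "\<dots> \<le> 2 * (\<integral>\<^sup>+x. r * f x \<partial>M)"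
      using N by (intro lacunary_maximal) auto
    also have "\<dots> = 2 * (r * (\<integral>\<^sup>+x. f x \<partial>M))" by (simp add: nn_integral_cmult)
    finally have "B * emeasure M D \<le> B * (2 * (r * (\<integral>\<^sup>+x. f x \<partial>M)))" by (intro mult_left_mono) auto
    also have "\<dots> = 2 * (B * r) * (\<integral>\<^sup>+x. f x \<partial>M)" by (simp add: ac_simps)
    finally show ?thesis by (simp add: Br)
  qed
  have sum_G: "(\<Sum>l<R. \<integral>\<^sup>+x. G l x \<partial>M) + of_nat a * (\<integral>\<^sup>+x. w 0 x \<partial>M) \<le> of_nat a * (\<integral>\<^sup>+x. w R x \<partial>M)" for R
  proof (induction R)
    case (Suc R)
    have "(\<Sum>l<Suc R. \<integral>\<^sup>+x. G l x \<partial>M) + of_nat a * (\<integral>\<^sup>+x. w 0 x \<partial>M)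
      = (\<integral>\<^sup>+x. G R x \<partial>M) + ((\<Sum>l<R. \<integral>\<^sup>+x. G l x \<partial>M) + of_nat a * (\<integral>\<^sup>+x. w 0 x \<partial>M))"
      by (simp add: ac_simps)
    also have "\<dots> \<le> (\<integral>\<^sup>+x. G R x \<partial>M) + of_nat a * (\<integral>\<^sup>+x. w R x \<partial>M)" by (intro add_left_mono Suc)
    finally show ?case using G_int[of R] by order
  qed simp
  have "emeasure M {x \<in> space M. \<exists>l<R. \<exists>i\<le>N. 4 * 2 ^ b \<le> Pn (2 ^ Suc l * (N + i)) f x}
      \<le> emeasure M (E \<union> (\<Union>l<R. A' l))"
    by (intro emeasure_mono sub) measurable
  also have "\<dots> \<le> emeasure M E + (\<Sum>l<R. emeasure M (A' l))"
    by (intro order_trans[OF emeasure_subadditive] add_left_mono emeasure_subadditive_finite) auto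
  finally have "B * emeasure M {x \<in> space M. \<exists>l<R. \<exists>i\<le>N. 4 * 2 ^ b \<le> Pn (2 ^ Suc l * (N + i)) f x}
      \<le> B * (emeasure M E + (\<Sum>l<R. emeasure M (A' l)))"
    by (intro mult_left_mono) auto
  also have "\<dots> = B * emeasure M E + (\<Sum>l<R. B * emeasure M (A' l))"
    by (simp add: distrib_left sum_distrib_left)
  \<comment> \<open>Here \<open>1536 = 24 * 64\<close>, with \<open>24 = 3 * 8\<close> from the
    layers over \<open>D\<close> and \<open>64 = 2 * 32\<close> from the bound for
    \<open>D\<close>.\<close>
  also have "\<dots> \<le> 1536 * (\<integral>\<^sup>+x. f x \<partial>M) + of_nat a * (\<integral>\<^sup>+x. f x \<partial>M)"
  proof (intro add_mono)
    have "emeasure M E = (\<integral>\<^sup>+x. indicator E x \<partial>M)" by simp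
    also have "\<dots> \<le> (\<integral>\<^sup>+x. H x \<partial>M)"
      by (intro nn_integral_mono) (auto simp: E_def indicator_def)
    also have "\<dots> \<le> 24 * emeasure M D" using H_int by (simp add: nn_integral_cmult mult.assoc[symmetric])
    finally have "B * emeasure M E \<le> B * (24 * emeasure M D)" by (intro mult_left_mono) auto
    also have "\<dots> = 24 * (B * emeasure M D)" by (simp add: ac_simps)
    also have "\<dots> \<le> 24 * (64 * (\<integral>\<^sup>+x. f x \<partial>M))" by (intro mult_left_mono BD) auto
    finally show "B * emeasure M E \<le> 1536 * (\<integral>\<^sup>+x. f x \<partial>M)" by (simp add: mult.assoc[symmetric])
    have "(\<Sum>l<R. B * emeasure M (A' l)) \<le> (\<Sum>l<R. \<integral>\<^sup>+x. G l x \<partial>M)"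
    proof (intro sum_mono)
      fix l
      have "B * emeasure M (A' l) = (\<integral>\<^sup>+x. B * indicator (A' l) x \<partial>M)" by (simp add: nn_integral_cmult)
      also have "\<dots> \<le> (\<integral>\<^sup>+x. G l x \<partial>M)"
        by (intro nn_integral_mono) (auto simp: A'_def indicator_def)
      finally show "B * emeasure M (A' l) \<le> (\<integral>\<^sup>+x. G l x \<partial>M)" .
    qed
    also have "\<dots> \<le> of_nat a * (\<integral>\<^sup>+x. w R x \<partial>M)"
      by (rule order_trans[OF _ sum_G]) (simp add: le_iff_add)
    also have "(\<integral>\<^sup>+x. w R x \<partial>M) \<le> (\<integral>\<^sup>+x. Pn (2 ^ Suc R * N) f x \<partial>M)"
      by (intro nn_integral_mono) (simp add: w_def)
    also have "\<dots> = (\<integral>\<^sup>+x. f x \<partial>M)" by (rule nn_integral_Pn) measurable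
    finally show "(\<Sum>l<R. B * emeasure M (A' l)) \<le> of_nat a * (\<integral>\<^sup>+x. f x \<partial>M)"
      by (simp add: mult_left_mono)
  qed
  also have "\<dots> = of_nat (1536 + a) * (\<integral>\<^sup>+x. f x \<partial>M)"
    by (simp add: distrib_right)
  also have "1536 + a = b + 1538" by (simp add: a_def)
  finally show ?thesis by (simp add: B_def)
qed

text \<open>Homogeneity: multiplying \<open>f\<close> by the threshold \<open>4 * 2 ^ b\<close>
  cancels \<open>2 ^ b\<close> and leaves only the factor 4, so the dependence on \<open>N\<close>
  is logarithmic.\<close>

lemma maximal_weak_type:
  assumes [measurable]: "f \<in> borel_measurable M" and N: "N > 0" "N \<le> 2 ^ b"
  shows "emeasure M {x \<in> space M. \<exists>l<R. \<exists>i\<le>N. 1 \<le> Pn (2 ^ Suc l * (N + i)) f x}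
    \<le> of_nat (4 * (b + 1538)) * (\<integral>\<^sup>+x. f x \<partial>M)" (is "emeasure M ?F \<le> _")
proof -
  define c :: ennreal where "c = 4 * 2 ^ b"
  have c: "c \<noteq> 0" "c \<noteq> top" by (auto simp: c_def power_eq_top_ennreal ennreal_mult_eq_top_iff)
  have F: "?F = {x \<in> space M. \<exists>l<R. \<exists>i\<le>N. c \<le> Pn (2 ^ Suc l * (N + i)) (\<lambda>x. c * f x) x}"
  proof -
    have "1 \<le> y \<longleftrightarrow> c \<le> c * y" for y
      using ennreal_mult_le_mult_iff[OF c, of 1 y] by simp
    then show ?thesis by (intro Collect_cong) (simp add: Pn_cmult del: power_Suc cong: conj_cong)
  qed
  have "2 ^ b * emeasure M ?F \<le> of_nat (b + 1538) * (\<integral>\<^sup>+x. c * f x \<partial>M)"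
    unfolding F c_def by (rule maximal_weak_type_power) (use N in auto)
  also have "\<dots> = 2 ^ b * (of_nat (4 * (b + 1538)) * (\<integral>\<^sup>+x. f x \<partial>M))"
    unfolding nn_integral_cmult[OF assms(1)] c_def of_nat_mult of_nat_numeral by (simp only: ac_simps)
  finally show ?thesis
    by (simp add: ennreal_mult_le_mult_iff power_eq_top_ennreal)
qed

end

subsection \<open>The Gaussian kernel\<close>

text \<open>The heat kernel at time \<open>v / 2\<close>. The variance \<open>v\<close> serves as
  the time parameter and adds up under composition.\<close>

definition gauss :: "nat \<Rightarrow> real \<Rightarrow> (nat \<Rightarrow> real) \<Rightarrow> (nat \<Rightarrow> real) \<Rightarrow> ennreal" where
  "gauss n v x y = (\<Prod>i<n. ennreal (normal_density 0 (sqrt v) (x i - y i)))"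

abbreviation borel_n :: "nat \<Rightarrow> (nat \<Rightarrow> real) measure" where
  "borel_n n \<equiv> Pi\<^sub>M {..<n} (\<lambda>_. lborel)"

lemma nn_integral_normal_density:
  assumes "v > 0"
  shows "(\<integral>\<^sup>+y. ennreal (normal_density 0 (sqrt v) (c - y)) \<partial>lborel) = 1"
proof -
  interpret prob_space "density lborel (\<lambda>x. ennreal (normal_density c (sqrt v) x))"
    using assms by (intro prob_space_normal_density) auto
  have "(\<integral>\<^sup>+y. ennreal (normal_density 0 (sqrt v) (c - y)) \<partial>lborel)
      = (\<integral>\<^sup>+y. ennreal (normal_density c (sqrt v) y) \<partial>lborel)"
    by (intro nn_integral_cong) (simp add: normal_density_def power2_commute)
  also have "\<dots> = 1"
    using emeasure_space_1 by (simp add: emeasure_density)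
  finally show ?thesis .
qed

lemma nn_integral_normal_density_mult:
  assumes "v > 0" "w > 0"
  shows "(\<integral>\<^sup>+y. ennreal (normal_density 0 (sqrt v) (a - y)) * ennreal (normal_density 0 (sqrt w) (y - b)) \<partial>lborel)
    = ennreal (normal_density 0 (sqrt (v + w)) (a - b))"
proof -
  have "(\<integral>\<^sup>+y. ennreal (normal_density 0 (sqrt v) (a - y)) * ennreal (normal_density 0 (sqrt w) (y - b)) \<partial>lborel)
    = (\<integral>\<^sup>+y. ennreal (normal_density 0 (sqrt v) (a - b - y) * normal_density 0 (sqrt w) y) \<partial>lborel)"
    by (subst nn_integral_real_affine[where c = 1 and t = b]) (auto simp: ennreal_mult algebra_simps)
  also have "\<dots> = ennreal (normal_density 0 (sqrt (v + w)) (a - b))"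
    using fun_cong[OF conv_normal_density_zero_mean[of "sqrt v" "sqrt w"], of "a - b"] assms by simp
  finally show ?thesis .
qed

interpretation lborel_product: product_sigma_finite "\<lambda>_ :: nat. lborel :: real measure"
  by standard

lemma gauss_symmetric_markov_kernel:
  assumes v: "v > 0"
  shows "symmetric_markov_kernel (borel_n n) (gauss n v)"
proof -
  interpret sigma_finite_measure "borel_n n"
    by (rule lborel_product.sigma_finite) simp
  show ?thesis
  proof
    show "case_prod (gauss n v) \<in> borel_measurable (borel_n n \<Otimes>\<^sub>M borel_n n)"
      unfolding gauss_def by measurable
    show "gauss n v x y = gauss n v y x" for x y
      by (simp add: gauss_def normal_density_def power2_commute)
    show "(\<integral>\<^sup>+y. gauss n v x y \<partial>borel_n n) = 1" for x
      unfolding gauss_def using v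
      by (subst lborel_product.product_nn_integral_prod[where f = "\<lambda>i y. ennreal (normal_density 0 (sqrt v) (x i - y))"])
        (auto simp: nn_integral_normal_density)
  qed
qed

lemma nn_integral_gauss_mult:
  assumes "v > 0" "w > 0"
  shows "(\<integral>\<^sup>+y. gauss n v x y * gauss n w y z \<partial>borel_n n) = gauss n (v + w) x z"
  unfolding gauss_def prod.distrib[symmetric]
  by (subst lborel_product.product_nn_integral_prod[where f = "\<lambda>i y.
        ennreal (normal_density 0 (sqrt v) (x i - y)) * ennreal (normal_density 0 (sqrt w) (y - z i))"])
    (auto simp: nn_integral_normal_density_mult assms)

abbreviation heat :: "nat \<Rightarrow> real \<Rightarrow> nat \<Rightarrow> ((nat \<Rightarrow> real) \<Rightarrow> ennreal) \<Rightarrow> (nat \<Rightarrow> real) \<Rightarrow> ennreal" where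
  "heat n v m \<equiv> symmetric_markov_kernel.P (borel_n n) (gauss n v) ^^ m"

text \<open>Chapman-Kolmogorov, by \<open>nn_integral_gauss_mult\<close>. The induction starts at
  one step, the zeroth power being the identity.\<close>

lemma heat_eq:
  assumes v: "v > 0" and m: "m > 0" and [measurable]: "f \<in> borel_measurable (borel_n n)"
    and x: "x \<in> space (borel_n n)"
  shows "heat n v m f x = (\<integral>\<^sup>+y. gauss n (real m * v) x y * f y \<partial>borel_n n)"
proof -
  interpret symmetric_markov_kernel "borel_n n" "gauss n v"
    by (rule gauss_symmetric_markov_kernel[OF v])
  interpret pair_sigma_finite "borel_n n" "borel_n n" ..
  have [measurable]: "(\<lambda>(y, z). gauss n w y z) \<in> borel_measurable (borel_n n \<Otimes>\<^sub>M borel_n n)" for w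
    unfolding gauss_def by measurable
  have [measurable]: "(\<lambda>z. gauss n w x z) \<in> borel_measurable (borel_n n)"
     "(\<lambda>z. gauss n w z x) \<in> borel_measurable (borel_n n)" for w x
    unfolding gauss_def by measurable
  have "Pn (Suc k) f x = (\<integral>\<^sup>+y. gauss n (real (Suc k) * v) x y * f y \<partial>borel_n n)"
    if "x \<in> space (borel_n n)" for k
    using that
  proof (induction k arbitrary: x)
    case 0
    then show ?case by (simp add: P_def)
  next
    case (Suc k)
    define w where "w = real (Suc k) * v"
    have w: "w > 0" using v by (simp add: w_def)
    have "Pn (Suc (Suc k)) f x = P (\<lambda>y. \<integral>\<^sup>+z. gauss n w y z * f z \<partial>borel_n n) x"
      unfolding funpow.simps(2)[of "Suc k"] comp_def w_def by (intro P_cong Suc.IH)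
    also have "\<dots> = (\<integral>\<^sup>+y. \<integral>\<^sup>+z. gauss n v x y * (gauss n w y z * f z) \<partial>borel_n n \<partial>borel_n n)"
      unfolding P_def by (intro nn_integral_cong nn_integral_cmult[symmetric]) measurable
    also have "\<dots> = (\<integral>\<^sup>+z. \<integral>\<^sup>+y. gauss n v x y * (gauss n w y z * f z) \<partial>borel_n n \<partial>borel_n n)"
      by (rule Fubini'[symmetric]) (use Suc.prems in measurable)
    also have "\<dots> = (\<integral>\<^sup>+z. gauss n (v + w) x z * f z \<partial>borel_n n)"
    proof (intro nn_integral_cong)
      fix z assume "z \<in> space (borel_n n)"
      have "(\<integral>\<^sup>+y. gauss n v x y * (gauss n w y z * f z) \<partial>borel_n n)
          = (\<integral>\<^sup>+y. gauss n v x y * gauss n w y z \<partial>borel_n n) * f z"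
        by (subst nn_integral_multc[symmetric]) (auto simp: mult.assoc)
      then show "(\<integral>\<^sup>+y. gauss n v x y * (gauss n w y z * f z) \<partial>borel_n n) = gauss n (v + w) x z * f z"
        by (simp add: nn_integral_gauss_mult v w)
    qed
    finally show ?case by (simp add: w_def algebra_simps)
  qed
  from this[OF x, of "m - 1"] m show ?thesis by simp
qed

subsection \<open>Balls and Gaussians\<close>

text \<open>An upper Stirling bound, by induction in steps of two through the functional equation of
  \<open>Gamma\<close>.\<close>

lemma Gamma_half_le:
  assumes "n \<ge> 1"
  shows "Gamma (real n / 2 + 1) \<le> 3 * sqrt (real n) * sqrt (real n / (2 * exp 1)) ^ n"
  using assms
proof (induction n rule: less_induct)
  case (less n)
  have e: "exp 1 \<le> (3 :: real)" by (rule exp_le)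
  consider "n = 1" | "n = 2" | "n \<ge> 3" using less.prems by linarith
  then show ?case
  proof cases
    case 1
    have "(1 / 2 :: real) \<notin> \<int>\<^sub>\<le>\<^sub>0"
      by (auto elim!: nonpos_Ints_cases)
    then have "Gamma (3 / 2 :: real) = sqrt pi / 2"
      using Gamma_plus1[of "1 / 2 :: real"] by (simp add: Gamma_one_half_real add.commute)
    also have "\<dots> \<le> sqrt 4 / 2" using pi_less_4 by (intro divide_right_mono real_sqrt_le_mono) auto
    also have "\<dots> \<le> 3 * sqrt (1 / 9)" by (simp add: real_sqrt_divide)
    also have "\<dots> \<le> 3 * sqrt (1 / (2 * exp 1))"
      using e by (intro mult_left_mono real_sqrt_le_mono divide_left_mono) auto
    finally show ?thesis using 1 by (simp add: add.commute)
  next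
    case 2
    have "1 \<le> 3 * (sqrt 1 * (1 / 3 :: real))" by simp
    also have "\<dots> \<le> 3 * (sqrt 2 * (1 / exp 1))"
      using e by (intro mult_left_mono mult_mono real_sqrt_le_mono divide_left_mono) auto
    finally show ?thesis using 2 by (simp add: Gamma_fact[of 1, simplified] power2_eq_square)
  next
    case 3
    define k where "k = n - 2"
    have k: "k \<ge> 1" "n = k + 2" "k < n" using 3 by (auto simp: k_def)
    define s where "s j = sqrt (real j / (2 * exp 1))" for j
    have s_pos: "s j > 0" if "j \<ge> 1" for j using that by (simp add: s_def)
    have s_n: "s n = s k * sqrt (real n / real k)"
      using k by (simp add: s_def flip: real_sqrt_mult)
    \<comment> \<open>The midpoint bound for the integral of the convex function
      \<open>1 / t\<close> from \<open>k\<close> to \<open>k + 2\<close> supplies exactly the factor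
      \<open>exp 1\<close> that the induction step needs.\<close>
    have e_le: "exp 1 \<le> sqrt (real n / real k) ^ (k + 1)"
    proof -
      have "2 / (real k + 1) \<le> ln (real n) - ln (real k)"
        using ln_inverse_approx_ge[of "real k" "real n"] k by (simp add: field_simps)
      then have "1 \<le> real (k + 1) * (ln (real n / real k) / 2)"
        using k by (simp add: ln_div field_simps)
      also have "\<dots> = ln (sqrt (real n / real k) ^ (k + 1))"
        using k by (subst ln_realpow) (auto simp: ln_sqrt)
      finally show ?thesis using k by (subst ln_ge_iff[symmetric]) auto
    qed
    have "Gamma (real n / 2 + 1) = (real k / 2 + 1) * Gamma (real k / 2 + 1)"
    proof -
      have "real k / 2 + 1 \<notin> \<int>\<^sub>\<le>\<^sub>0"
        by (auto elim!: nonpos_Ints_cases)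
      then show ?thesis
        using Gamma_plus1[of "real k / 2 + 1"] k by (simp add: add_ac add_divide_distrib)
    qed
    also have "\<dots> \<le> (real n / 2) * (3 * sqrt (real k) * s k ^ k)"
      using less.IH[OF k(3) k(1)] k by (intro mult_mono) (auto simp: s_def add_divide_distrib)
    also have "\<dots> = 3 * (real n / (2 * exp 1)) * sqrt (real k) * s k ^ k * exp 1"
      by simp
    also have "\<dots> \<le> 3 * (real n / (2 * exp 1)) * sqrt (real k) * s k ^ k * sqrt (real n / real k) ^ (k + 1)"
      using k s_pos[of k] by (intro mult_left_mono e_le) auto
    also have "\<dots> = 3 * (real n / (2 * exp 1)) * (sqrt (real k) * sqrt (real n / real k)) * (s k * sqrt (real n / real k)) ^ k"
      by (simp add: power_mult_distrib)
    also have "sqrt (real k) * sqrt (real n / real k) = sqrt (real n)"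
      using k by (simp flip: real_sqrt_mult)
    also have "3 * (real n / (2 * exp 1)) * sqrt (real n) * (s k * sqrt (real n / real k)) ^ k
       = 3 * sqrt (real n) * s n ^ n"
    proof -
      have "real n / (2 * exp 1) = s n ^ 2" by (simp add: s_def)
      then show ?thesis unfolding s_n[symmetric] by (simp add: k(2) power_add power2_eq_square)
    qed
    finally show ?thesis by (simp add: s_def)
  qed
qed

text \<open>
  The Gaussian lives on a shell of relative width \<open>1 / sqrt n\<close>, a ball on one of relative width
  \<open>1 / n\<close>; this is where the factor \<open>sqrt n\<close> is lost.
\<close>

lemma inverse_ball_volume_le:
  assumes n: "n \<ge> 1" and r: "r > 0" and v: "r\<^sup>2 \<le> real n * v" "real n * v \<le> r\<^sup>2 * (1 + 1 / real n)"
  shows "1 / (unit_ball_vol (real n) * r ^ n)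
    \<le> 3 * exp (1 / 2) * sqrt (real n) * ((1 / sqrt (2 * pi * v)) ^ n * exp (- r\<^sup>2 / (2 * v)))"
proof -
  have v_pos: "v > 0"
    using v(1) r n by (metis less_le_trans mult_le_0_iff not_le of_nat_0_le_iff zero_less_power)
  have "pi powr (real n / 2) = sqrt pi ^ n"
    by (simp add: powr_half_sqrt[symmetric] powr_realpow[symmetric] powr_powr)
  then have "1 / (unit_ball_vol (real n) * r ^ n) = Gamma (real n / 2 + 1) / (sqrt pi * r) ^ n"
    by (simp add: unit_ball_vol_def power_mult_distrib)
  also have "\<dots> \<le> 3 * sqrt (real n) * sqrt (real n / (2 * exp 1)) ^ n / (sqrt pi * r) ^ n"
    using r by (intro divide_right_mono Gamma_half_le n) auto
  also have "\<dots> = 3 * sqrt (real n) * (sqrt (real n / (2 * exp 1)) / (sqrt pi * r)) ^ n"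
    by (simp add: power_divide)
  also have "\<dots> \<le> 3 * sqrt (real n) * (exp (1 / (2 * real n)) * (1 / sqrt (2 * pi * v)) * exp (- 1 / 2)) ^ n"
  proof (intro mult_left_mono power_mono)
    have "sqrt (real n / (2 * exp 1)) / (sqrt pi * r) = sqrt (real n / (r\<^sup>2 * (2 * pi * exp 1)))"
      using r by (simp add: real_sqrt_mult real_sqrt_divide)
    also have "\<dots> \<le> sqrt (exp (1 / real n) / (2 * pi * v * exp 1))"
    proof (intro real_sqrt_le_mono)
      \<comment> \<open>The relative slack \<open>1 / n\<close> in \<open>v\<close>, halved by the
        root and then raised to the power \<open>n\<close>, costs only
        \<open>exp (1 / 2)\<close>.\<close>
      have "real n * v \<le> r\<^sup>2 * exp (1 / real n)"
        using v(2) exp_ge_add_one_self[of "1 / real n"] by (meson mult_left_mono order_trans zero_le_power2)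
      then have "(real n * v) * (2 * pi * exp 1) \<le> (r\<^sup>2 * exp (1 / real n)) * (2 * pi * exp 1)"
        by (intro mult_right_mono) auto
      then show "real n / (r\<^sup>2 * (2 * pi * exp 1)) \<le> exp (1 / real n) / (2 * pi * v * exp 1)"
        using r v_pos by (simp add: field_simps)
    qed
    also have "\<dots> = exp (1 / (2 * real n)) * (1 / sqrt (2 * pi * v)) * exp (- 1 / 2)"
    proof -
      have "sqrt (exp t) = exp (t / 2)" for t :: real
        by (rule real_sqrt_unique) (auto simp: power2_eq_square simp flip: exp_add)
      then show ?thesis by (simp add: real_sqrt_mult real_sqrt_divide exp_minus field_simps)
    qed
    finally show "sqrt (real n / (2 * exp 1)) / (sqrt pi * r)
        \<le> exp (1 / (2 * real n)) * (1 / sqrt (2 * pi * v)) * exp (- 1 / 2)" .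
  qed (use r in auto)
  also have "\<dots> = 3 * sqrt (real n) * (exp (1 / 2) * (1 / sqrt (2 * pi * v)) ^ n * exp (- real n / 2))"
  proof -
    have "exp (1 / (2 * real n)) ^ n = exp (1 / 2)" "exp (- 1 / 2) ^ n = exp (- real n / 2)"
      using n by (simp_all flip: exp_of_nat_mult)
    then show ?thesis by (simp only: power_mult_distrib)
  qed
  also have "\<dots> \<le> 3 * sqrt (real n) * (exp (1 / 2) * (1 / sqrt (2 * pi * v)) ^ n * exp (- r\<^sup>2 / (2 * v)))"
    using v(1) v_pos by (intro mult_left_mono) (auto simp: field_simps)
  finally show ?thesis by (simp add: ac_simps)
qed

text \<open>The density decreases radially, so inside the ball it is at least its value on the
  sphere.\<close>

lemma gauss_ge:
  assumes v: "v > 0" and y: "L2_set (\<lambda>i. y i - x i) {..<n} < r"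
  shows "ennreal ((1 / sqrt (2 * pi * v)) ^ n * exp (- r\<^sup>2 / (2 * v))) \<le> gauss n v x y"
proof -
  have "(\<Sum>i<n. (x i - y i)\<^sup>2) = (L2_set (\<lambda>i. y i - x i) {..<n})\<^sup>2"
    by (simp add: L2_set_def sum_nonneg power2_commute)
  also have "\<dots> \<le> r\<^sup>2" using y by (intro power_mono) auto
  finally have le: "(\<Sum>i<n. (x i - y i)\<^sup>2) \<le> r\<^sup>2" .
  have "gauss n v x y = ennreal (\<Prod>i<n. 1 / sqrt (2 * pi * v) * exp (- (x i - y i)\<^sup>2 / (2 * v)))"
    unfolding gauss_def using v by (subst prod_ennreal[symmetric]) (auto simp: normal_density_def)
  also have "(\<Prod>i<n. 1 / sqrt (2 * pi * v) * exp (- (x i - y i)\<^sup>2 / (2 * v)))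
      = (1 / sqrt (2 * pi * v)) ^ n * exp (- (\<Sum>i<n. (x i - y i)\<^sup>2) / (2 * v))"
    by (simp add: prod_dividef exp_sum[symmetric] sum_negf sum_divide_distrib power_divide)
  finally show ?thesis
    using le v by (auto intro!: ennreal_leI mult_left_mono divide_right_mono)
qed

text \<open>In the octave containing \<open>\<tau>\<close>, with spacing \<open>u\<close>, round
  \<open>\<tau> / u\<close> up. The error is at most \<open>u\<close>, and
  \<open>u * N \<le> \<tau>\<close> makes it at most \<open>\<tau> / N\<close>.\<close>

lemma dyadic_grid:
  assumes N: "N > 0" and "real (2 * N) \<le> \<tau>" "\<tau> < real (2 ^ Suc R * N)"
  shows "\<exists>l<R. \<exists>i\<le>N. \<tau> \<le> real (2 ^ Suc l * (N + i)) \<and> real (2 ^ Suc l * (N + i)) \<le> \<tau> * (1 + 1 / real N)"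
  using assms(2,3)
proof (induction R)
  case (Suc R)
  show ?case
  proof (cases "\<tau> < real (2 ^ Suc R * N)")
    case False
    define u :: real where "u = 2 ^ Suc R"
    have u: "u > 0" and lo: "u * real N \<le> \<tau>" and hi: "\<tau> < 2 * (u * real N)"
      using False Suc.prems by (auto simp: u_def)
    define k where "k = nat \<lceil>\<tau> / u\<rceil>"
    have "0 \<le> \<tau> / u"
      using u by (intro divide_nonneg_pos order_trans[OF _ lo]) auto
    then have k: "real k = of_int \<lceil>\<tau> / u\<rceil>"
      unfolding k_def by simp
    have "u * (\<tau> / u) \<le> u * real k" "u * real k \<le> u * (\<tau> / u + 1)"
      unfolding k using u by (intro mult_left_mono; simp)+
    then have k1: "\<tau> \<le> u * real k" "u * real k \<le> \<tau> + u"
      using u by (simp_all add: distrib_left)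
    have "N \<le> k"
      using order_trans[OF lo k1(1)] u by simp
    moreover have "k \<le> 2 * N"
    proof -
      have "\<lceil>\<tau> / u\<rceil> \<le> int (2 * N)" using hi u by (intro ceiling_le) (auto simp: field_simps)
      then show ?thesis unfolding k_def by linarith
    qed
    moreover have "\<tau> + u \<le> \<tau> * (1 + 1 / real N)"
      using lo N by (simp add: field_simps)
    ultimately show ?thesis
      using k1 by (intro exI[of _ R] conjI exI[of _ "k - N"]) (auto simp: u_def of_nat_diff)
  qed (use Suc in \<open>auto intro: less_SucI\<close>)
qed auto

subsection \<open>The maximal function\<close>

text \<open>
  The heat extension is sampled at the variances \<open>2\<^sup>l\<^sup>+\<^sup>1 (n + i) / 2\<^sup>j\<close>, whose successive ratios are at
  most \<open>1 + 1 / n\<close> and whose range exhausts the positive half line as \<open>j\<close> grows.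
\<close>

definition heat_superlevel :: "nat \<Rightarrow> ((nat \<Rightarrow> real) \<Rightarrow> ennreal) \<Rightarrow> nat \<Rightarrow> (nat \<Rightarrow> real) set" where
  "heat_superlevel n h j = {x \<in> space (borel_n n).
     \<exists>l<2 * j. \<exists>i\<le>n. 1 \<le> heat n (1 / 2 ^ j) (2 ^ Suc l * (n + i)) h x}"

text \<open>The abstract inequality with \<open>N = n\<close>. Its constant ignores the kernel, so
  the bound is uniform in \<open>j\<close> although the time step shrinks.\<close>

lemma heat_superlevel:
  assumes [measurable]: "h \<in> borel_measurable (borel_n n)" and n: "n \<ge> 1" "n \<le> 2 ^ b"
  shows "heat_superlevel n h j \<in> sets (borel_n n)"
    and "emeasure (borel_n n) (heat_superlevel n h j) \<le> of_nat (4 * (b + 1538)) * (\<integral>\<^sup>+x. h x \<partial>borel_n n)"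
proof -
  interpret symmetric_markov_kernel "borel_n n" "gauss n (1 / 2 ^ j)"
    by (rule gauss_symmetric_markov_kernel) simp
  show "heat_superlevel n h j \<in> sets (borel_n n)"
    unfolding heat_superlevel_def by measurable
  show "emeasure (borel_n n) (heat_superlevel n h j) \<le> of_nat (4 * (b + 1538)) * (\<integral>\<^sup>+x. h x \<partial>borel_n n)"
    unfolding heat_superlevel_def using n by (intro maximal_weak_type) auto
qed

text \<open>Pointwise, the normalised indicator of the ball is at most the stated multiple of the
  Gaussian: \<open>gauss_ge\<close> bounds the latter below on the ball and
  \<open>inverse_ball_volume_le\<close> compares the constants.\<close>

lemma ball_average_le_heat:
  assumes [measurable]: "g \<in> borel_measurable (borel_n n)" and n: "n \<ge> 1"
    and x: "x \<in> space (borel_n n)" and r: "r > 0" and \<epsilon>: "\<epsilon> > 0" and m: "m > 0"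
    and v: "r\<^sup>2 \<le> real n * (real m * \<epsilon>)" "real n * (real m * \<epsilon>) \<le> r\<^sup>2 * (1 + 1 / real n)"
  shows "(\<integral>\<^sup>+y\<in>ball_n n x r. g y \<partial>borel_n n) / ennreal (unit_ball_vol (real n) * r ^ n)
    \<le> ennreal (3 * exp (1 / 2) * sqrt (real n)) * heat n \<epsilon> m g x"
proof -
  define w where "w = real m * \<epsilon>"
  have w: "w > 0" using m \<epsilon> by (simp add: w_def)
  define c where "c = unit_ball_vol (real n) * r ^ n"
  have c: "c > 0" using r by (simp add: c_def)
  have [measurable]: "(\<lambda>y. gauss n w x y) \<in> borel_measurable (borel_n n)"
    unfolding gauss_def by measurable
  have "(\<integral>\<^sup>+y\<in>ball_n n x r. g y \<partial>borel_n n) / ennreal c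
      = ennreal (1 / c) * (\<integral>\<^sup>+y\<in>ball_n n x r. g y \<partial>borel_n n)"
    using c by (simp add: divide_ennreal_def inverse_ennreal inverse_eq_divide mult.commute)
  also have "\<dots> \<le> ennreal (1 / c) * (\<integral>\<^sup>+y. ennreal c * (ennreal (3 * exp (1 / 2) * sqrt (real n)) * (gauss n w x y * g y)) \<partial>borel_n n)"
  proof (intro mult_left_mono nn_integral_mono)
    fix y assume "y \<in> space (borel_n n)"
    show "g y * indicator (ball_n n x r) y \<le> ennreal c * (ennreal (3 * exp (1 / 2) * sqrt (real n)) * (gauss n w x y * g y))"
    proof (cases "y \<in> ball_n n x r")
      case True
      define e where "e = (1 / sqrt (2 * pi * w)) ^ n * exp (- r\<^sup>2 / (2 * w))"
      have "1 / c \<le> 3 * exp (1 / 2) * sqrt (real n) * e"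
        unfolding c_def e_def by (rule inverse_ball_volume_le) (use n r v in \<open>auto simp: w_def\<close>)
      then have "1 \<le> c * (3 * exp (1 / 2) * sqrt (real n) * e)"
        using c by (simp add: field_simps)
      then have "1 \<le> ennreal (c * (3 * exp (1 / 2) * sqrt (real n) * e))"
        by simp
      also have "\<dots> = ennreal c * (ennreal (3 * exp (1 / 2) * sqrt (real n)) * ennreal e)"
        using c by (simp add: ennreal_mult' flip: ennreal_mult)
      also have "\<dots> \<le> ennreal c * (ennreal (3 * exp (1 / 2) * sqrt (real n)) * gauss n w x y)"
        using True unfolding e_def by (intro mult_left_mono gauss_ge w) (auto simp: ball_n_def)
      finally have "1 * g y \<le> ennreal c * (ennreal (3 * exp (1 / 2) * sqrt (real n)) * gauss n w x y) * g y"
        by (intro mult_right_mono) auto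
      then show ?thesis using True by (simp add: mult.assoc)
    qed simp
  qed auto
  also have "\<dots> = ennreal (1 / c) * ennreal c * (ennreal (3 * exp (1 / 2) * sqrt (real n)) * (\<integral>\<^sup>+y. gauss n w x y * g y \<partial>borel_n n))"
    by (simp add: nn_integral_cmult mult.assoc)
  also have "ennreal (1 / c) * ennreal c = 1"
    using c by (simp flip: ennreal_mult)
  also have "(\<integral>\<^sup>+y. gauss n w x y * g y \<partial>borel_n n) = heat n \<epsilon> m g x"
    unfolding w_def by (rule heat_eq[symmetric]) (use \<epsilon> m x in auto)
  finally show ?thesis by (simp add: c_def)
qed

lemma eventually_in_heat_superlevel:
  assumes [measurable]: "g \<in> borel_measurable (borel_n n)" and n: "n \<ge> 1" and \<alpha>: "\<alpha> > 0"
    and x: "x \<in> space (borel_n n)" and r: "r > 0"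
    and gt: "ennreal \<alpha> < (\<integral>\<^sup>+y\<in>ball_n n x r. g y \<partial>borel_n n) / ennreal (unit_ball_vol (real n) * r ^ n)"
  shows "\<exists>k. \<forall>j\<ge>k. x \<in> heat_superlevel n (\<lambda>y. ennreal (3 * exp (1 / 2) * sqrt (real n) / \<alpha>) * g y) j"
proof -
  \<comment> \<open>Beyond \<open>k1\<close> the time sought lies above the bottom
    \<open>2 * n\<close> of the grid, beyond \<open>k2\<close> below its top.\<close>
  obtain k1 where k1: "2 * (real n)\<^sup>2 / r\<^sup>2 < 2 ^ k1"
    using real_arch_pow[of 2] by force
  obtain k2 where k2: "r\<^sup>2 < 2 ^ k2"
    using real_arch_pow[of 2] by force
  have "x \<in> heat_superlevel n (\<lambda>y. ennreal (3 * exp (1 / 2) * sqrt (real n) / \<alpha>) * g y) j"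
    if j: "j \<ge> max k1 k2" for j
  proof -
    define \<epsilon> :: real where "\<epsilon> = 1 / 2 ^ j"
    have \<epsilon>: "\<epsilon> > 0" by (simp add: \<epsilon>_def)
    interpret symmetric_markov_kernel "borel_n n" "gauss n \<epsilon>"
      by (rule gauss_symmetric_markov_kernel[OF \<epsilon>])
    \<comment> \<open>The variance \<open>r\<^sup>2 / n\<close>, at which the Gaussian concentrates
      near radius \<open>r\<close>, in units of the time step.\<close>
    define \<tau> where "\<tau> = r\<^sup>2 * 2 ^ j / real n"
    have "(2 :: real) ^ k1 \<le> 2 ^ j" "(2 :: real) ^ k2 \<le> 2 ^ j"
      using j by (auto intro: power_increasing)
    with k1 k2 have "2 * (real n)\<^sup>2 / r\<^sup>2 < 2 ^ j" and r_less: "r\<^sup>2 < 2 ^ j"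
      by linarith+
    then have 1: "real (2 * n) \<le> \<tau>"
      using r n by (simp add: \<tau>_def field_simps power2_eq_square)
    have 2: "\<tau> < real (2 ^ Suc (2 * j) * n)"
    proof -
      have "\<tau> \<le> r\<^sup>2 * 2 ^ j"
        using n r by (simp add: \<tau>_def divide_le_eq)
      also have "\<dots> < 2 ^ j * 2 ^ j" using r_less by simp
      also have "(2 :: real) ^ j * 2 ^ j = 2 ^ (2 * j)"
        by (simp only: mult_2 power_add)
      also have "\<dots> \<le> 2 ^ (2 * j) * (2 * real n)"
        using n by simp
      also have "\<dots> = real (2 ^ Suc (2 * j) * n)"
        by simp
      finally show ?thesis .
    qed
    obtain l i where l: "l < 2 * j" and i: "i \<le> n"
      and T: "\<tau> \<le> real (2 ^ Suc l * (n + i))" "real (2 ^ Suc l * (n + i)) \<le> \<tau> * (1 + 1 / real n)"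
      using dyadic_grid[OF _ 1 2] n by auto
    define m where "m = 2 ^ Suc l * (n + i)"
    have m: "m > 0" using n by (simp add: m_def)
    have r2: "r\<^sup>2 = real n * (\<tau> * \<epsilon>)" using n by (simp add: \<tau>_def \<epsilon>_def)
    have "r\<^sup>2 \<le> real n * (real m * \<epsilon>)"
      unfolding r2 using T(1) \<epsilon> by (intro mult_left_mono mult_right_mono) (auto simp: m_def)
    moreover have "real n * (real m * \<epsilon>) \<le> r\<^sup>2 * (1 + 1 / real n)"
    proof -
      have "real n * (real m * \<epsilon>) \<le> real n * ((\<tau> * (1 + 1 / real n)) * \<epsilon>)"
        using T(2) \<epsilon> by (intro mult_left_mono mult_right_mono) (auto simp: m_def)
      then show ?thesis unfolding r2 by (simp only: ac_simps)
    qed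
    ultimately have "ennreal \<alpha> \<le> ennreal (3 * exp (1 / 2) * sqrt (real n)) * Pn m g x"
      using ball_average_le_heat[of g n x r \<epsilon> m] n x r \<epsilon> m gt by auto
    then have "ennreal (1 / \<alpha>) * ennreal \<alpha> \<le> ennreal (1 / \<alpha>) * (ennreal (3 * exp (1 / 2) * sqrt (real n)) * Pn m g x)"
      by (intro mult_left_mono) auto
    also have "\<dots> = Pn m (\<lambda>y. ennreal (3 * exp (1 / 2) * sqrt (real n) / \<alpha>) * g y) x"
      using \<alpha> x by (simp add: Pn_cmult mult.assoc[symmetric] flip: ennreal_mult)
    finally have "1 \<le> Pn m (\<lambda>y. ennreal (3 * exp (1 / 2) * sqrt (real n) / \<alpha>) * g y) x"
      using \<alpha> by (simp flip: ennreal_mult)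
    then show ?thesis
      using x l i unfolding heat_superlevel_def \<epsilon>_def m_def by blast
  qed
  then show ?thesis by blast
qed

text \<open>The tail intersections increase, so continuity from below applies and the sets for
  different \<open>j\<close> need not be compared.\<close>

lemma emeasure_liminf_le:
  assumes [measurable]: "\<And>j::nat. G j \<in> sets M" and "\<And>j. emeasure M (G j) \<le> c"
  shows "emeasure M (\<Union>k. \<Inter>j\<in>{k..}. G j) \<le> c"
proof -
  have "emeasure M (\<Union>k. \<Inter>j\<in>{k..}. G j) = (SUP k. emeasure M (\<Inter>j\<in>{k..}. G j))"
    by (intro SUP_emeasure_incseq[symmetric]) (auto simp: incseq_def)
  also have "\<dots> \<le> c"
  proof (intro SUP_least)
    fix k
    have "emeasure M (\<Inter>j\<in>{k..}. G j) \<le> emeasure M (G k)" by (intro emeasure_mono) auto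
    then show "emeasure M (\<Inter>j\<in>{k..}. G j) \<le> c" using assms(2) order_trans by blast
  qed
  finally show ?thesis .
qed

lemma maximal_fun_weak_type:
  fixes f :: "(nat \<Rightarrow> real) \<Rightarrow> complex"
  assumes n: "n \<ge> 1" "n \<le> 2 ^ b" and f: "integrable (lebesgue_n n) f"
  shows "weak_L1_quasinorm n (maximal_fun n f)
    \<le> ennreal (real (4 * (b + 1538)) * (3 * exp (1 / 2) * sqrt (real n)) * (\<integral>x. norm (f x) \<partial>lebesgue_n n))"
proof -
  define I where "I = (\<integral>x. norm (f x) \<partial>lebesgue_n n)"
  have I: "I \<ge> 0" by (simp add: I_def)
  have "(\<lambda>x. ennreal (norm (f x))) \<in> borel_measurable (completion (borel_n n))"
    using f unfolding lebesgue_n_def by measurable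
  \<comment> \<open>The kernels live on the Borel product, whereas \<open>f\<close> is measurable
    for its completion only. A Borel version of the norm has the same ball averages.\<close>
  then obtain g where g [measurable]: "g \<in> borel_measurable (borel_n n)"
    and AE: "AE x in borel_n n. ennreal (norm (f x)) = g x"
    using completion_ex_borel_measurable by blast
  have "(\<integral>\<^sup>+x. g x \<partial>borel_n n) = (\<integral>\<^sup>+x. ennreal (norm (f x)) \<partial>borel_n n)"
    using AE by (intro nn_integral_cong_AE) auto
  also have "\<dots> = (\<integral>\<^sup>+x. ennreal (norm (f x)) \<partial>lebesgue_n n)"
    by (simp add: lebesgue_n_def nn_integral_completion)
  also have "\<dots> = ennreal I"
    unfolding I_def using f by (intro nn_integral_eq_integral) auto
  finally have int_g: "(\<integral>\<^sup>+x. g x \<partial>borel_n n) = ennreal I" .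
  have space: "space (lebesgue_n n) = space (borel_n n)" by (simp add: lebesgue_n_def)
  have avg: "(\<integral>\<^sup>+y\<in>ball_n n x r. ennreal (norm (f y)) \<partial>lebesgue_n n) = (\<integral>\<^sup>+y\<in>ball_n n x r. g y \<partial>borel_n n)" for x r
    unfolding lebesgue_n_def nn_integral_completion using AE by (intro nn_integral_cong_AE) auto
  show ?thesis unfolding weak_L1_quasinorm_def I_def[symmetric]
  proof (intro SUP_least)
    fix \<alpha> :: real assume "\<alpha> \<in> {0<..}"
    then have \<alpha>: "\<alpha> > 0" by simp
    define s where "s = 3 * exp (1 / 2) * sqrt (real n)"
    have s: "s \<ge> 0" by (simp add: s_def)
    define G where "G = heat_superlevel n (\<lambda>y. ennreal (s / \<alpha>) * g y)"
    have G_sets [measurable]: "G j \<in> sets (borel_n n)" for j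
      unfolding G_def by (rule heat_superlevel(1)) (use n in measurable)
    have "emeasure (borel_n n) (G j) \<le> of_nat (4 * (b + 1538)) * (\<integral>\<^sup>+x. ennreal (s / \<alpha>) * g x \<partial>borel_n n)" for j
      unfolding G_def by (rule heat_superlevel(2)) (use n in measurable)
    also have "of_nat (4 * (b + 1538)) * (\<integral>\<^sup>+x. ennreal (s / \<alpha>) * g x \<partial>borel_n n)
        = ennreal (real (4 * (b + 1538)) * (s / \<alpha> * I))"
      using s \<alpha> I unfolding ennreal_of_nat_eq_real_of_nat
      by (simp add: nn_integral_cmult int_g flip: ennreal_mult del: of_nat_mult of_nat_add)
    finally have G_le: "emeasure (borel_n n) (G j) \<le> ennreal (real (4 * (b + 1538)) * (s / \<alpha> * I))" for j .
    have sub: "{x \<in> space (lebesgue_n n). ennreal \<alpha> < maximal_fun n f x} \<subseteq> (\<Union>k. \<Inter>j\<in>{k..}. G j)"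
    proof safe
      fix x assume x: "x \<in> space (lebesgue_n n)" and "ennreal \<alpha> < maximal_fun n f x"
      then obtain r where "r > 0" and
        "ennreal \<alpha> < (\<integral>\<^sup>+y\<in>ball_n n x r. g y \<partial>borel_n n) / ennreal (unit_ball_vol (real n) * r ^ n)"
        unfolding maximal_fun_def less_SUP_iff avg by auto
      then have "\<exists>k. \<forall>j\<ge>k. x \<in> G j"
        unfolding G_def s_def using x n \<alpha> by (intro eventually_in_heat_superlevel) (auto simp: space)
      then show "x \<in> (\<Union>k. \<Inter>j\<in>{k..}. G j)" by auto
    qed
    have meas: "(\<Union>k. \<Inter>j\<in>{k..}. G j) \<in> sets (borel_n n)" by measurable
    have "emeasure (lebesgue_n n) {x \<in> space (lebesgue_n n). ennreal \<alpha> < maximal_fun n f x}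
        \<le> emeasure (lebesgue_n n) (\<Union>k. \<Inter>j\<in>{k..}. G j)"
      using sub meas by (intro emeasure_mono) (auto simp: lebesgue_n_def)
    also have "\<dots> = emeasure (borel_n n) (\<Union>k. \<Inter>j\<in>{k..}. G j)"
      using meas by (simp add: lebesgue_n_def)
    also have "\<dots> \<le> ennreal (real (4 * (b + 1538)) * (s / \<alpha> * I))"
      by (intro emeasure_liminf_le G_le) measurable
    finally have "ennreal \<alpha> * emeasure (lebesgue_n n) {x \<in> space (lebesgue_n n). ennreal \<alpha> < maximal_fun n f x}
        \<le> ennreal \<alpha> * ennreal (real (4 * (b + 1538)) * (s / \<alpha> * I))"
      by (intro mult_left_mono) auto
    also have "\<dots> = ennreal (\<alpha> * (real (4 * (b + 1538)) * (s / \<alpha> * I)))"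
      using \<alpha> by (subst ennreal_mult') auto
    also have "\<alpha> * (real (4 * (b + 1538)) * (s / \<alpha> * I)) = real (4 * (b + 1538)) * s * I"
      using \<alpha> by simp
    finally show "ennreal \<alpha> * emeasure (lebesgue_n n) {x \<in> space (lebesgue_n n). ennreal \<alpha> < maximal_fun n f x}
        \<le> ennreal (real (4 * (b + 1538)) * (3 * exp (1 / 2) * sqrt (real n)) * I)"
      by (simp add: s_def)
  qed
qed

theorem theorem1p1:
  "\<exists>C::real. C > 0 \<and>
     (\<forall>n::nat. n \<ge> 1 \<longrightarrow>
       (\<forall>f :: (nat \<Rightarrow> real) \<Rightarrow> complex. integrable (lebesgue_n n) f \<longrightarrow>
          weak_L1_quasinorm n (maximal_fun n f)
            \<le> ennreal (C * sqrt (real n) * ln (1 + real n) * (\<integral>x. norm (f x) \<partial>lebesgue_n n))))"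
proof (intro exI conjI allI impI)
  \<comment> \<open>With \<open>L = ln (1 + n) / ln 2 \<ge> 1\<close> and
    \<open>b \<le> L + 1\<close>, the factor \<open>4 * b + 6152\<close> is at most
    \<open>4 * L + 6156\<close>, hence at most \<open>6160 * L\<close>.\<close>
  define C where "C = 6160 / ln 2 * (3 * exp (1 / 2 :: real))"
  show "C > 0" by (simp add: C_def)
  fix n :: nat and f :: "(nat \<Rightarrow> real) \<Rightarrow> complex"
  assume n: "n \<ge> 1" and f: "integrable (lebesgue_n n) f"
  define b where "b = nat \<lceil>log 2 (real n)\<rceil>"
  have log_nonneg: "0 \<le> log 2 (real n)" using n by simp
  have "log 2 (real n) \<le> real b" unfolding b_def by linarith
  then have "real n \<le> 2 powr real b" using n by (simp add: log_le_iff)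
  then have "real n \<le> real (2 ^ b)" by (simp add: powr_realpow)
  then have nb: "n \<le> 2 ^ b" by (simp only: of_nat_le_iff)
  have "real b \<le> log 2 (real n) + 1" unfolding b_def using log_nonneg by linarith
  also have "log 2 (real n) \<le> ln (1 + real n) / ln 2"
    using n by (simp add: log_def divide_right_mono)
  finally have "real b \<le> ln (1 + real n) / ln 2 + 1" by simp
  moreover have "1 \<le> ln (1 + real n) / ln 2" using n by (simp add: le_divide_eq)
  moreover have "real (4 * (b + 1538)) = 4 * real b + 6152" by simp
  ultimately have "real (4 * (b + 1538)) \<le> 6160 * (ln (1 + real n) / ln 2)" by linarith
  then have b: "real (4 * (b + 1538)) \<le> 6160 / ln 2 * ln (1 + real n)" by simp
  have "weak_L1_quasinorm n (maximal_fun n f)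
    \<le> ennreal (real (4 * (b + 1538)) * (3 * exp (1 / 2) * sqrt (real n)) * (\<integral>x. norm (f x) \<partial>lebesgue_n n))"
    by (rule maximal_fun_weak_type[OF n nb f])
  also have "\<dots> \<le> ennreal (6160 / ln 2 * ln (1 + real n) * (3 * exp (1 / 2) * sqrt (real n)) * (\<integral>x. norm (f x) \<partial>lebesgue_n n))"
    by (intro ennreal_leI mult_right_mono b) auto
  also have "6160 / ln 2 * ln (1 + real n) * (3 * exp (1 / 2) * sqrt (real n)) * (\<integral>x. norm (f x) \<partial>lebesgue_n n)
      = C * sqrt (real n) * ln (1 + real n) * (\<integral>x. norm (f x) \<partial>lebesgue_n n)"
    by (simp add: C_def)
  finally show "weak_L1_quasinorm n (maximal_fun n f)
    \<le> ennreal (C * sqrt (real n) * ln (1 + real n) * (\<integral>x. norm (f x) \<partial>lebesgue_n n))" .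
qed

end
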